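(* Let $m$, $n$, and $r$ be positive integers and $q$ an indeterminate. Then each of the three expressions $$ \sum_{k=0}^{n-1}\frac{(1-q^{m})(1-q^{m+1})(1-q^{2k+1})}{(1-q^2)(1-q^n)^2}D_q(m,k)\,D_{q^{-1}}(m,k)\,q^{-k}, $$ $$ \sum_{k=0}^{n-1}\frac{1-q^{2k+1}}{1-q^n}D_q(m,k)^r\, D_{q^{-1}}(m,k)^r\, q^{-k}, $$ $$ \sum_{k=0}^{n-1}(-1)^{n-k-1}\frac{1-q^{2k+1}}{1-q^n}D_q(m,k)^r\, D_{q^{-1}}(m,k)^r\, q^{\binom{k}{2}} $$ is a Laurent polynomial in $q$ with non-negative integer coefficients.
   Context: The $q$-shifted factorial is $(a;q)_0=1$ and $(a;q)_k=(1-a)(1-aq)\cdots(1-aq^{k-1})$ for $k\geq 1$. The $q$-binomial coefficient is ${n\brack k}=\frac{(q;q)_n}{(q;q)_k(q;q)_{n-k}}$ if $n\ge k\ge 0$, and ${n\brack k}=0$ otherwise. The $q$-Delannoy numbers are $$ D_q(m,n)=\sum_{k=0}^{n}q^{\binom{k}{2}}{n\brack k}{n+m-k\brack n}\qquad (m,n\ge 0), $$ a polynomial in $q$ with integer coefficients, and $D_{q^{-1}}(m,n)$ denotes the Laurent polynomial obtained from it by replacing $q$ by $q^{-1}$. *)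

theory Defs
  imports "HOL-Computational_Algebra.Computational_Algebra"
begin

definition qpoch :: "'a::field \<Rightarrow> 'a \<Rightarrow> nat \<Rightarrow> 'a" where
  "qpoch a q k = (\<Prod>i<k. 1 - a * q ^ i)"

text \<open>The base \<open>q\<close> of the following two functions is an element of a field that is not a root
  of unity; otherwise the denominator may vanish.\<close>

definition qbinom :: "'a::field \<Rightarrow> nat \<Rightarrow> nat \<Rightarrow> 'a" where
  "qbinom q n k = (if k \<le> n then qpoch q q n / (qpoch q q k * qpoch q q (n - k)) else 0)"

definition qDelannoy :: "'a::field \<Rightarrow> nat \<Rightarrow> nat \<Rightarrow> 'a" where
  "qDelannoy q m n = (\<Sum>k=0..n. q ^ (k choose 2) * qbinom q n k * qbinom q (n + m - k) n)"

text \<open>The indeterminate \<open>q\<close>, as an element of the field of rational functions, realised as the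
  fraction field of \<open>\<int>[q]\<close>. In this field \<open>D\<close> at \<open>q\<^sup>-\<^sup>1\<close> is
  \<open>qDelannoy (inverse qvar)\<close>.\<close>

definition qvar :: "int poly fract" where
  "qvar = to_fract [:0, 1:]"

text \<open>The elements of \<open>\<nat>[q, q\<^sup>-\<^sup>1]\<close>: here \<open>c i\<close> is the coefficient of \<open>q\<^sup>i\<close>, \<open>i\<close> an integer.\<close>

definition nonneg_laurent_poly :: "int poly fract \<Rightarrow> bool" where
  "nonneg_laurent_poly f \<longleftrightarrow>
     (\<exists>c :: int \<Rightarrow> int. finite {i. c i \<noteq> 0} \<and> (\<forall>i. c i \<ge> 0) \<and>
        f = (\<Sum>i | c i \<noteq> 0. of_int (c i) * qvar powi i))"

end

theory Submission
  imports Defs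
begin

text \<open>Let \<open>e\<^sub>j(k) = q^(-jk) (\<Prod>i=1..j. (1 - q^(k+i)) (1 - q^(k+1-i))) / (q;q)\<^sub>j\<^sup>2\<close>. Up to the
  constant \<open>1/(q;q)\<^sub>j\<^sup>2\<close> this is the Newton polynomial of degree \<open>j\<close> in the variable
  \<open>q^(-k) + q^(k+1)\<close> with nodes \<open>q^(1-i) + q^i\<close>, \<open>i = 1, ..., j\<close>. Every claim follows from the
  behaviour of this basis (\<open>newton_basis\<close>).

  First, \<open>D\<^sub>q(m,k) D\<^bsub>1/q\<^esub>(m,k)\<close> is the sum over \<open>j\<close> of
  \<open>q^(j\<^sup>2-mj) (-1;q)\<^sub>j (-q;q)\<^sub>j [m+j, 2j] e\<^sub>j(k)\<close> (\<open>qDelannoy_product\<close>), so its coefficients lie in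
  \<open>\<nat>[q, 1/q]\<close>. Second, \<open>e\<^sub>i e\<^sub>j\<close> is again a combination of the \<open>e\<^sub>l\<close> with coefficients in
  \<open>\<nat>[q, 1/q]\<close>, namely products of three \<open>q\<close>-binomials (\<open>newton_basis_linearization\<close>), so the same
  is true of all powers of \<open>D\<^sub>q D\<^bsub>1/q\<^esub>\<close>. Third, the two weighted sums of \<open>e\<^sub>j(k)\<close> over \<open>k < n\<close>
  telescope, and after division by \<open>1 - q^n\<close> they are products of two \<open>q\<close>-binomials and a power of \<open>q\<close>
  (\<open>newton_positive_imp_sum\<close>, \<open>newton_basis_alternating_sum\<close>). This proves the second and the third claim. In the
  first claim further factors have to be divided out; they are absorbed by the coefficients of \<open>D\<^sub>q D\<^bsub>1/q\<^esub>\<close>,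
  one at a time (\<open>nonneg_laurent_poly_weighted_coeff\<close>).

  The expansion of \<open>D\<^sub>q D\<^bsub>1/q\<^esub>\<close> is the main step. With \<open>G(z) = (-qz;q)\<^bsub>m-1\<^esub> / (z;q)\<^bsub>m+1\<^esub>\<close>, the
  generating functions in \<open>n\<close> of \<open>D\<^sub>q(m,n)\<close> and of \<open>q^(mn) D\<^bsub>1/q\<^esub>(m,n)\<close> are \<open>(1 + z) G(z)\<close> and
  \<open>(1 + q^m z) G(z)\<close>. So the product is a quadratic form in two consecutive coefficients
  \<open>G\<^sub>n\<close>, \<open>G\<^bsub>n-1\<^esub>\<close>. These satisfy a three-term recurrence, which becomes a linear system of difference
  equations for \<open>U\<^sub>n = q^(-mn) G\<^sub>n\<^sup>2\<close> and \<open>V\<^sub>n = q^(-mn) G\<^sub>n G\<^bsub>n-1\<^esub>\<close>. The system is solved by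
  expansions of \<open>U\<close> and \<open>V\<close> in products centred like the Newton basis, with a two-term recurrence
  for the coefficients (\<open>square_mixed_expansion\<close>).\<close>

section \<open>Elementary identities\<close>

text \<open>The identity behind the two-step difference of the centred products: \<open>a\<close> stands for \<open>q^j\<close> and
  \<open>R\<close> for the factor common to all terms, the centred product with index \<open>j\<close> at \<open>qy\<close>.\<close>

lemma centred_prod_diff_identity:
  fixes q a y R :: "'a::field"
  assumes "q \<noteq> 0" "a \<noteq> 0" "y \<noteq> 0"
  shows "(1 - q * (q * y)) * (R * (1 - q * a * (q * y)) * (1 - q * (q * a) * (q * y)) / (q * (q * a) * (q * y)))
        - (1 - y) * (R * (q * a - q * y) * (1 - y / (q * a)) / y)
      = (1 + q * y) * (1 - q * q * a) *
         ((1 + 1 / (q * q * a)) * (R * (1 - q * a * (q * y)) * (1 - (q * y) / (q * a)) / (q * y))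
          + (1 - q * a) * (1 / (q * q * q * a * a) - 1) * R)"
  using assms by (simp add: field_simps)

text \<open>The three contributions to one Newton coefficient of \<open>D\<^sub>q D\<^bsub>1/q\<^esub>\<close>, with \<open>x = q^m\<close> and
  \<open>a = q^(j+1)\<close>, combine to a product. The denominator \<open>1 - a\<close> is kept opaque as \<open>b\<close>, for otherwise
  normalisation multiplies out its square.\<close>

lemma delannoy_coeff_balance:
  fixes a b x w :: "'a::field"
  assumes "x \<noteq> 0" "a \<noteq> 0" "b \<noteq> 0" and b: "b = 1 - a"
  shows "w * (1 + 1 / a) + w * ((1 + a) * (1 - x / a) * (1 - x * a) / (x * b)) / b
          + (1 + x) * (w * (1 - x) / (x * b))
        = 2 * w * (1 - x) * (1 - x * a) / (x * b\<^sup>2)"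
proof -
  have "x * b\<^sup>2 * (1 + 1 / a) + (1 + a) * (1 - x / a) * (1 - x * a) + (1 + x) * (1 - x) * b
      = 2 * (1 - x) * (1 - x * a)"
    using assms(2) unfolding b by (simp add: field_simps power2_eq_square)
  then have "w * 2 * (1 - x) * (1 - x * a) / (x * b\<^sup>2)
      = w * (x * b\<^sup>2 * (1 + 1 / a) + (1 + a) * (1 - x / a) * (1 - x * a) + (1 + x) * (1 - x) * b) / (x * b\<^sup>2)"
    by (simp only: mult.assoc)
  also have "\<dots> = w * (1 + 1 / a) + w * ((1 + a) * (1 - x / a) * (1 - x * a) / (x * b)) / b
          + (1 + x) * (w * (1 - x) / (x * b))"
    unfolding distrib_left[of w "_ + _"] distrib_left[of w "_ * _"] add_divide_distrib using assms(1,3) by (simp add: power2_eq_square mult_ac)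
  finally show ?thesis by (simp only: mult_ac)
qed

lemma eq_divideI:
  fixes a b c :: "'a::field"
  shows "c \<noteq> 0 \<Longrightarrow> c * a = b \<Longrightarrow> a = b / c"
  by (auto simp: mult.commute)

lemma choose_2_Suc: "Suc n choose 2 = (n choose 2) + n"
  by (simp add: numeral_2_eq_2)

section \<open>q-binomial coefficients at a generic base\<close>

text \<open>For the algebraic identities all that matters about the indeterminate is that it is a nonzero
  element of a field and not a root of unity; the inverse of such an element is again of this kind.\<close>

locale generic_base =
  fixes q :: "'a::field"
  assumes base_nonzero [simp]: "q \<noteq> 0"
    and not_root_of_unity: "n > 0 \<Longrightarrow> q ^ n \<noteq> 1"
begin

lemma one_minus_power_nonzero: "n > 0 \<Longrightarrow> 1 - q ^ n \<noteq> 0"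
  using not_root_of_unity by auto

lemma one_minus_power_Suc_nonzero [simp]: "1 - q ^ Suc n \<noteq> 0"
  using not_root_of_unity[of "Suc n"] by auto

lemma qpoch_0 [simp]: "qpoch q q 0 = 1"
  by (simp add: qpoch_def)

lemma qpoch_Suc: "qpoch q q (Suc n) = qpoch q q n * (1 - q ^ Suc n)"
  by (simp add: qpoch_def)

lemma qpoch_nonzero [simp]: "qpoch q q n \<noteq> 0"
  by (induction n)
    (simp_all only: qpoch_0 qpoch_Suc mult_eq_0_iff one_minus_power_Suc_nonzero one_neq_zero
      not_False_eq_True simp_thms)

lemma qbinom_0_right [simp]: "qbinom q n 0 = 1"
  by (simp add: qbinom_def)

lemma qbinom_self [simp]: "qbinom q n n = 1"
  by (simp add: qbinom_def)

lemma qbinom_eq_0: "n < k \<Longrightarrow> qbinom q n k = 0"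
  by (simp add: qbinom_def)

lemma qbinom_Suc_Suc:
  "(1 - q ^ Suc k) * qbinom q (Suc n) (Suc k) = (1 - q ^ Suc n) * qbinom q n k"
proof (cases "k \<le> n")
  case True
  have "qpoch q q (Suc k) = qpoch q q k * (1 - q ^ Suc k)" "1 - q ^ Suc k \<noteq> 0"
    by (simp_all only: qpoch_Suc one_minus_power_Suc_nonzero not_False_eq_True)
  then show ?thesis
    using True by (simp add: qbinom_def qpoch_Suc[of n] del: power_Suc)
qed (simp add: qbinom_def)

lemma qbinom_Suc_upper:
  "(1 - q ^ (Suc n - k)) * qbinom q (Suc n) k = (1 - q ^ Suc n) * qbinom q n k"
proof (cases "k \<le> n")
  case True
  then have e: "Suc n - k = Suc (n - k)" by simp
  have "1 - q ^ Suc (n - k) \<noteq> 0" by (rule one_minus_power_Suc_nonzero)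
  then show ?thesis
    using True unfolding e by (simp add: qbinom_def e qpoch_Suc del: power_Suc)
qed (auto simp: qbinom_def not_le less_Suc_eq_le)

lemma qbinom_Suc_lower:
  "(1 - q ^ Suc k) * qbinom q n (Suc k) = (1 - q ^ (n - k)) * qbinom q n k"
proof (cases n)
  case (Suc n')
  then show ?thesis
    using qbinom_Suc_Suc[of k n'] qbinom_Suc_upper[of n' k] by simp
qed (simp add: qbinom_def)

lemma qbinom_Pascal:
  "qbinom q (Suc n) (Suc k) = qbinom q n k + q ^ Suc k * qbinom q n (Suc k)"
proof (cases "k \<le> n")
  case True
  have nz: "1 - q ^ Suc k \<noteq> 0" by (rule one_minus_power_Suc_nonzero)
  have pw: "q ^ Suc k * q ^ (n - k) = q ^ Suc n"
    using True by (metis add_Suc le_add_diff_inverse power_add)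
  have "(1 - q ^ Suc k) * (qbinom q n k + q ^ Suc k * qbinom q n (Suc k))
      = (1 - q ^ Suc k) * qbinom q n k + q ^ Suc k * ((1 - q ^ Suc k) * qbinom q n (Suc k))"
    by (simp only: algebra_simps)
  also have "\<dots> = (1 - q ^ Suc k + (q ^ Suc k - q ^ Suc k * q ^ (n - k))) * qbinom q n k"
    unfolding qbinom_Suc_lower by (simp add: algebra_simps del: power_Suc)
  also have "\<dots> = (1 - q ^ Suc k) * qbinom q (Suc n) (Suc k)"
    unfolding pw qbinom_Suc_Suc by simp
  finally show ?thesis
    using nz by (metis mult_cancel_left)
qed (simp add: qbinom_def)

lemma qbinom_Pascal':
  "qbinom q (Suc n) (Suc k) = q ^ (n - k) * qbinom q n k + qbinom q n (Suc k)"
  using qbinom_Pascal[of n k] qbinom_Suc_lower[of k n] by (simp add: algebra_simps)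

text \<open>Both sides are the \<open>q\<close>-multinomial coefficient of \<open>k\<close>, \<open>m - k\<close>, \<open>n - k\<close>. This is the symmetry
  of the \<open>q\<close>-Delannoy numbers in \<open>m\<close> and \<open>n\<close>, term by term.\<close>

lemma qbinom_mult_swap:
  assumes "k \<le> n"
  shows "qbinom q n k * qbinom q (n + m - k) n = qbinom q m k * qbinom q (n + m - k) m"
proof (cases "k \<le> m")
  case True
  then have "n + m - k - n = m - k" "n + m - k - m = n - k" "n \<le> n + m - k" "m \<le> n + m - k"
    using assms by auto
  then show ?thesis
    using assms True by (simp add: qbinom_def)
qed (use assms in \<open>auto simp: qbinom_def\<close>)

lemma qpoch_inverse: "qpoch (inverse q) (inverse q) n = (- 1) ^ n * qpoch q q n / q ^ (Suc n choose 2)"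
proof (induction n)
  case (Suc n)
  have "Suc (Suc n) choose 2 = (Suc n choose 2) + Suc n"
    by (simp add: numeral_2_eq_2)
  moreover have "1 - inverse q ^ Suc n = - (1 - q ^ Suc n) / q ^ Suc n"
    by (simp add: field_simps)
  moreover have "qpoch (inverse q) (inverse q) (Suc n)
      = qpoch (inverse q) (inverse q) n * (1 - inverse q ^ Suc n)"
    by (simp add: qpoch_def)
  ultimately show ?case
    by (simp only: Suc.IH qpoch_Suc power_add) (simp add: field_simps)
qed (simp add: qpoch_def numeral_2_eq_2)

lemma qbinom_inverse: "q ^ (k * (n - k)) * qbinom (inverse q) n k = qbinom q n k"
proof (cases "k \<le> n")
  case True
  then obtain d where n: "n = k + d" by (auto simp: le_iff_add)
  have tri: "Suc (k + d) choose 2 = (Suc k choose 2) + (Suc d choose 2) + k * d"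
    by (induction d) (simp_all add: numeral_2_eq_2 algebra_simps)
  show ?thesis
    unfolding n qbinom_def qpoch_inverse
    by (simp add: tri power_add)
qed (simp add: qbinom_def)

section \<open>The common factor of the two generating functions\<close>

text \<open>The numerator \<open>(-qz;q)\<^bsub>m-1\<^esub>\<close> and the reciprocal \<open>1/(z;q)\<^bsub>m+1\<^esub>\<close> of the denominator of \<open>G(z)\<close>,
  given by their coefficients (the \<open>q\<close>-binomial theorem), since only coefficients are compared.\<close>

definition companion_num :: "nat \<Rightarrow> 'a fps" where
  "companion_num m = Abs_fps (\<lambda>k. q ^ (Suc k choose 2) * qbinom q (m - 1) k)"

definition companion_den :: "nat \<Rightarrow> 'a fps" where
  "companion_den m = Abs_fps (\<lambda>l. qbinom q (l + m) m)"

definition companion :: "nat \<Rightarrow> nat \<Rightarrow> 'a" where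
  "companion m n = fps_nth (companion_num m * companion_den m) n"

lemma qDelannoy_gf:
  "qDelannoy q m n = fps_nth (Abs_fps (\<lambda>k. q ^ (k choose 2) * qbinom q m k) * companion_den m) n"
proof -
  have "n + m - k = n - k + m" if "k \<le> n" for k
    using that by simp
  then show ?thesis
    unfolding qDelannoy_def fps_mult_nth companion_den_def
    by (intro sum.cong) (auto simp: qbinom_mult_swap mult.assoc)
qed

text \<open>Inverting the base divides \<open>[m,k]\<close> by \<open>q^(k(m-k))\<close> and \<open>[n+m-k,m]\<close> by \<open>q^(m(n-k))\<close>. Together with
  \<open>q^(-k(k-1)/2)\<close> this makes \<open>q^(k(k+1)/2 - mn)\<close>, so the factor \<open>q^(mn)\<close> clears all negative powers.\<close>

lemma qDelannoy_inverse_gf: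
  "q ^ (m * n) * qDelannoy (inverse q) m n
     = fps_nth (Abs_fps (\<lambda>k. q ^ (Suc k choose 2) * qbinom q m k) * companion_den m) n"
proof -
  interpret inv: generic_base "inverse q"
    by unfold_locales (auto simp: not_root_of_unity power_inverse)
  have "q ^ (m * n) * (inverse q ^ (k choose 2) * qbinom (inverse q) n k * qbinom (inverse q) (n + m - k) n)
      = q ^ (Suc k choose 2) * qbinom q m k * qbinom q (n - k + m) m" if kn: "k \<le> n" for k
  proof (cases "k \<le> m")
    case True
    obtain d where n: "n = k + d" using kn by (auto simp: le_iff_add)
    obtain e where m: "m = k + e" using True by (auto simp: le_iff_add)
    have sq: "(k choose 2) + (k choose 2) + k = k * k"
      by (induction k) (auto simp: choose_2_Suc numeral_2_eq_2)
    have "q ^ (m * n) = q ^ (Suc k choose 2) * q ^ (k choose 2) * q ^ (k * (m - k)) * q ^ (m * (n - k))"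
    proof -
      have "m * n = (Suc k choose 2) + (k choose 2) + k * (m - k) + m * (n - k)"
        using sq by (simp add: n m choose_2_Suc algebra_simps)
      then show ?thesis by (simp add: power_add)
    qed
    moreover have "qbinom (inverse q) n k * qbinom (inverse q) (n + m - k) n
        = qbinom (inverse q) m k * qbinom (inverse q) (n - k + m) m"
      using inv.qbinom_mult_swap[OF kn, of m] kn by simp
    ultimately have "q ^ (m * n) * (inverse q ^ (k choose 2) * qbinom (inverse q) n k * qbinom (inverse q) (n + m - k) n)
      = q ^ (Suc k choose 2) * (q ^ (k * (m - k)) * qbinom (inverse q) m k)
         * (q ^ (m * (n - k + m - m)) * qbinom (inverse q) (n - k + m) m) * (q ^ (k choose 2) * inverse q ^ (k choose 2))"
      by (simp add: mult_ac)
    also have "q ^ (k choose 2) * inverse q ^ (k choose 2) = 1"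
      by (simp add: power_inverse)
    finally show ?thesis
      by (simp only: qbinom_inverse mult_1_right)
  next
    case False
    then have "qbinom (inverse q) (n + m - k) n = 0" "qbinom q m k = 0"
      using kn by (auto simp: qbinom_def)
    then show ?thesis by simp
  qed
  then show ?thesis
    unfolding qDelannoy_def fps_mult_nth companion_den_def sum_distrib_left
    by (intro sum.cong) (auto simp del: inverse_eq_divide)
qed

lemma one_plus_const_X_nth:
  fixes c :: 'a
  shows "fps_nth ((1 + fps_const c * fps_X) * f) n = fps_nth f n + (if n = 0 then 0 else c * fps_nth f (n - 1))"
proof -
  have "(1 + fps_const c * fps_X) * f = f + fps_const c * (fps_X * f)"
    by (simp add: algebra_simps)
  then show ?thesis
    by (simp only: fps_add_nth fps_mult_left_const_nth fps_X_mult_nth) simp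
qed

text \<open>The two \<open>q\<close>-Pascal rules split the numerators of the two generating functions as \<open>1 + z\<close> and
  \<open>1 + q^m z\<close> times the same series; this makes the product \<open>D\<^sub>q D\<^bsub>1/q\<^esub>\<close> a quadratic form in the
  coefficients of one series. The cases \<open>n = 0\<close> stand alone because there is no preceding coefficient.\<close>

lemma qDelannoy_companion:
  assumes "m \<ge> 1"
  shows "qDelannoy q m (Suc n) = companion m (Suc n) + companion m n"
    and "q ^ (m * Suc n) * qDelannoy (inverse q) m (Suc n) = companion m (Suc n) + q ^ m * companion m n"
    and "qDelannoy q m 0 = companion m 0"
    and "qDelannoy (inverse q) m 0 = companion m 0"
proof -
  obtain M where m: "m = Suc M" using assms by (cases m) auto
  have "Abs_fps (\<lambda>k. q ^ (k choose 2) * qbinom q m k) = (1 + fps_const 1 * fps_X) * companion_num m"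
    unfolding fps_eq_iff one_plus_const_X_nth
  proof
    fix k
    show "fps_nth (Abs_fps (\<lambda>k. q ^ (k choose 2) * qbinom q m k)) k
        = fps_nth (companion_num m) k + (if k = 0 then 0 else 1 * fps_nth (companion_num m) (k - 1))"
      by (cases k) (simp_all add: companion_num_def m qbinom_Pascal choose_2_Suc power_add algebra_simps)
  qed
  then have D: "qDelannoy q m k = fps_nth ((1 + fps_const 1 * fps_X) * (companion_num m * companion_den m)) k" for k
    unfolding qDelannoy_gf by (simp add: mult.assoc)
  have "Abs_fps (\<lambda>k. q ^ (Suc k choose 2) * qbinom q m k) = (1 + fps_const (q ^ m) * fps_X) * companion_num m"
    unfolding fps_eq_iff one_plus_const_X_nth
  proof
    fix k
    show "fps_nth (Abs_fps (\<lambda>k. q ^ (Suc k choose 2) * qbinom q m k)) k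
        = fps_nth (companion_num m) k + (if k = 0 then 0 else q ^ m * fps_nth (companion_num m) (k - 1))"
    proof (cases k)
      case (Suc k')
      have "q ^ (Suc k choose 2) * q ^ (M - k') * qbinom q M k' = q ^ m * q ^ (Suc k' choose 2) * qbinom q M k'"
      proof (cases "k' \<le> M")
        case True
        then have "(Suc k choose 2) + (M - k') = m + (Suc k' choose 2)"
          by (simp add: Suc m choose_2_Suc)
        then show ?thesis by (metis power_add)
      qed (simp add: qbinom_eq_0)
      then show ?thesis
        by (simp add: companion_num_def m Suc qbinom_Pascal' distrib_left mult.assoc del: power_Suc)
    qed (simp add: companion_num_def)
  qed
  then have E: "q ^ (m * k) * qDelannoy (inverse q) m k
      = fps_nth ((1 + fps_const (q ^ m) * fps_X) * (companion_num m * companion_den m)) k" for k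
    unfolding qDelannoy_inverse_gf by (simp add: mult.assoc)
  show "qDelannoy q m (Suc n) = companion m (Suc n) + companion m n"
    unfolding D one_plus_const_X_nth companion_def by simp
  show "qDelannoy q m 0 = companion m 0"
    unfolding D one_plus_const_X_nth companion_def by simp
  show "q ^ (m * Suc n) * qDelannoy (inverse q) m (Suc n) = companion m (Suc n) + q ^ m * companion m n"
    unfolding E one_plus_const_X_nth companion_def by simp
  show "qDelannoy (inverse q) m 0 = companion m 0"
    using E[of 0] unfolding one_plus_const_X_nth companion_def by simp
qed

lemma companion_0: "companion m 0 = 1"
  by (simp add: companion_def companion_num_def companion_den_def numeral_2_eq_2)

text \<open>Replacing \<open>z\<close> by \<open>qz\<close> shifts the factors of each \<open>q\<close>-factorial by one place, so all but the end
  factors cancel in \<open>G(qz)/G(z)\<close>.\<close>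

lemma companion_functional_equation:
  assumes "m \<ge> 1"
  defines "G \<equiv> companion_num m * companion_den m"
  shows "(1 + fps_const q * fps_X) * ((1 + fps_const (- (q ^ Suc m)) * fps_X) * fps_compose G (fps_const q * fps_X))
       = (1 + fps_const (q ^ m) * fps_X) * ((1 + fps_const (- 1) * fps_X) * G)"
proof -
  obtain M where m: "m = Suc M" using assms by (cases m) auto
  have num: "(1 + fps_const q * fps_X) * fps_compose (companion_num m) (fps_const q * fps_X)
      = (1 + fps_const (q ^ m) * fps_X) * companion_num m"
    unfolding fps_eq_iff one_plus_const_X_nth fps_nth_compose_linear
  proof
    fix k
    show "q ^ k * fps_nth (companion_num m) k + (if k = 0 then 0 else q * (q ^ (k - 1) * fps_nth (companion_num m) (k - 1)))
        = fps_nth (companion_num m) k + (if k = 0 then 0 else q ^ m * fps_nth (companion_num m) (k - 1))"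
    proof (cases k)
      case (Suc k')
      have *: "q ^ Suc k' * (1 - q ^ (M - k')) * qbinom q M k' = (q ^ Suc k' - q ^ m) * qbinom q M k'"
      proof (cases "k' \<le> M")
        case True
        then have "Suc k' + (M - k') = m" by (simp add: m)
        then have "q ^ Suc k' * q ^ (M - k') = q ^ m" by (metis power_add)
        then show ?thesis by (simp add: right_diff_distrib)
      qed (simp add: qbinom_eq_0)
      have "(1 - q ^ Suc k') * (q ^ (Suc (Suc k') choose 2) * qbinom q M (Suc k'))
          = q ^ (Suc k' choose 2) * (q ^ Suc k' * ((1 - q ^ Suc k') * qbinom q M (Suc k')))"
        by (simp add: choose_2_Suc power_add)
      also have "\<dots> = q ^ (Suc k' choose 2) * ((q ^ Suc k' - q ^ m) * qbinom q M k')"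
        unfolding qbinom_Suc_lower using * by (simp only: mult.assoc)
      finally show ?thesis
        by (simp add: companion_num_def Suc m algebra_simps)
    qed simp
  qed
  have den: "(1 + fps_const (- (q ^ Suc m)) * fps_X) * fps_compose (companion_den m) (fps_const q * fps_X)
      = (1 + fps_const (- 1) * fps_X) * companion_den m"
    unfolding fps_eq_iff one_plus_const_X_nth fps_nth_compose_linear
  proof
    fix k
    show "q ^ k * fps_nth (companion_den m) k
            + (if k = 0 then 0 else - (q ^ Suc m) * (q ^ (k - 1) * fps_nth (companion_den m) (k - 1)))
        = fps_nth (companion_den m) k + (if k = 0 then 0 else - 1 * fps_nth (companion_den m) (k - 1))"
    proof (cases k)
      case (Suc k')
      then show ?thesis
        using qbinom_Suc_upper[of "k' + m" m]
        by (simp add: companion_den_def Suc_diff_le algebra_simps power_add)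
    qed simp
  qed
  have "fps_compose G (fps_const q * fps_X)
      = fps_compose (companion_num m) (fps_const q * fps_X) * fps_compose (companion_den m) (fps_const q * fps_X)"
    unfolding G_def by (rule fps_compose_mult_distrib) simp
  then have "(1 + fps_const q * fps_X) * ((1 + fps_const (- (q ^ Suc m)) * fps_X) * fps_compose G (fps_const q * fps_X))
      = ((1 + fps_const q * fps_X) * fps_compose (companion_num m) (fps_const q * fps_X))
        * ((1 + fps_const (- (q ^ Suc m)) * fps_X) * fps_compose (companion_den m) (fps_const q * fps_X))"
    by (simp only: mult_ac)
  then show ?thesis
    unfolding num den G_def by (simp only: mult_ac)
qed

text \<open>Coefficient comparison in the functional equation. The first part is the same recurrence at
  \<open>n = -1\<close>, with the convention \<open>G\<^bsub>-1\<^esub> = 0\<close>.\<close>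

lemma companion_recurrence:
  assumes "m \<ge> 1"
  shows "(1 - q) * companion m 1 = (1 - q ^ m) * (1 + q)"
    and "(1 - q ^ (n + 2)) * (companion m (n + 2) - q ^ m * companion m n)
           = (1 - q ^ m) * (1 + q ^ (n + 2)) * companion m (n + 1)"
proof -
  let ?G = "companion_num m * companion_den m"
  have eq: "fps_nth ((1 + fps_const q * fps_X) * ((1 + fps_const (- (q ^ Suc m)) * fps_X)
         * fps_compose ?G (fps_const q * fps_X))) k
       = fps_nth ((1 + fps_const (q ^ m) * fps_X) * ((1 + fps_const (- 1) * fps_X) * ?G)) k" for k
    using companion_functional_equation[OF assms] by simp
  show "(1 - q) * companion m 1 = (1 - q ^ m) * (1 + q)"
    using eq[of 1] companion_0[of m]
    unfolding one_plus_const_X_nth fps_nth_compose_linear companion_def[symmetric]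
    by (simp add: algebra_simps)
  show "(1 - q ^ (n + 2)) * (companion m (n + 2) - q ^ m * companion m n)
           = (1 - q ^ m) * (1 + q ^ (n + 2)) * companion m (n + 1)"
    using eq[of "n + 2"]
    unfolding one_plus_const_X_nth fps_nth_compose_linear companion_def[symmetric]
    by (simp add: algebra_simps)
qed

section \<open>Newton products and centred products\<close>

text \<open>As a function of \<open>y = q^k\<close> the Newton product is \<open>y^(-j)\<close> times the product of \<open>1 - q^i y\<close> for
  \<open>-j < i \<le> j\<close>; the centred product below is \<open>y^(-j-1)\<close> times the product for \<open>-j \<le> i \<le> j\<close>. They
  interlace: adjoining one end factor to either gives the other, up to a power of \<open>y\<close>, which makes differences factor.\<close>

primrec newton_prod :: "nat \<Rightarrow> 'a \<Rightarrow> 'a" where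
  "newton_prod 0 y = 1"
| "newton_prod (Suc j) y = newton_prod j y * (1 - y / q ^ j) / y * (1 - q ^ Suc j * y)"

definition centred_prod :: "nat \<Rightarrow> 'a \<Rightarrow> 'a" where
  "centred_prod j y = newton_prod j y * (1 - y / q ^ j) / y"

lemma newton_prod_Suc_centred: "newton_prod (Suc j) y = centred_prod j y * (1 - q ^ Suc j * y)"
  by (simp add: centred_prod_def)

lemma centred_prod_Suc:
  "centred_prod (Suc j) y = centred_prod j y * (1 - q ^ Suc j * y) * (1 - y / q ^ Suc j) / y"
  unfolding centred_prod_def[of "Suc j"] newton_prod_Suc_centred ..

text \<open>The shift \<open>y \<mapsto> qy\<close> moves the range of exponents by one, so the two products differ in their end
  factors. Both sides are multiplied by the factor lost at the lower end, because it may vanish.\<close>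

lemma newton_prod_shift:
  assumes "y \<noteq> 0"
  shows "newton_prod j (q * y) * (1 - q * y / q ^ j) = newton_prod j y * (1 - q ^ Suc j * y) / q ^ j"
proof (induction j)
  case (Suc j)
  let ?P = "newton_prod j"
  have "newton_prod (Suc j) (q * y) * (1 - q * y / q ^ Suc j)
      = (?P (q * y) * (1 - q * y / q ^ j)) * (1 - q ^ Suc j * (q * y)) * (1 - q * y / q ^ Suc j) / (q * y)"
    by simp
  also have "\<dots> = newton_prod (Suc j) y * (1 - q ^ Suc (Suc j) * y) / q ^ Suc j"
    unfolding Suc.IH using assms by (simp add: mult_ac)
  finally show ?case .
qed simp

lemma centred_prod_up:
  assumes "y \<noteq> 0"
  shows "centred_prod j (q * y) = newton_prod j y * (1 - q ^ Suc j * y) / (q ^ Suc j * y)"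
  using newton_prod_shift[OF assms, of j] assms by (simp add: centred_prod_def field_simps)

lemma newton_prod_down:
  assumes "y \<noteq> 0"
  shows "newton_prod (Suc j) y = centred_prod j (q * y) * (q ^ Suc j - q * y)"
  unfolding centred_prod_up[OF assms] using assms by (simp add: field_simps)

lemma newton_prod_1 [simp]: "newton_prod (Suc j) 1 = 0"
  by (induction j) auto

lemma centred_prod_1 [simp]: "centred_prod j 1 = 0"
  by (cases j) (auto simp: centred_prod_def simp del: newton_prod.simps(2))

lemma centred_prod_at_base: "centred_prod j q = (if j = 0 then (1 - q) / q else 0)"
  using newton_prod_1 by (cases j) (auto simp: centred_prod_up[of 1, simplified])

lemma newton_prod_diff:
  assumes "y \<noteq> 0"
  shows "newton_prod (Suc j) (q * y) - newton_prod (Suc j) y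
       = (1 - q ^ Suc j) * (1 + q * y) * centred_prod j (q * y)"
  unfolding newton_prod_down[OF assms] newton_prod_Suc_centred[of j "q * y"]
  by (simp add: algebra_simps)

lemma newton_prod_sum:
  assumes "y \<noteq> 0"
  shows "newton_prod (Suc j) (q * y) + newton_prod (Suc j) y
       = (1 + q ^ Suc j) * (1 - q * y) * centred_prod j (q * y)"
  unfolding newton_prod_down[OF assms] newton_prod_Suc_centred[of j "q * y"]
  by (simp add: algebra_simps)

text \<open>This converts \<open>U\<^sub>n + U\<^bsub>n-1\<^esub>\<close> from centred products to Newton products.\<close>

lemma centred_prod_sum:
  assumes "y \<noteq> 0"
  shows "(1 - q * y) * centred_prod j (q * y) + (1 - y) * centred_prod j y
       = (1 + 1 / q ^ Suc j) * newton_prod (Suc j) y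
         + (1 - q ^ Suc j) * (1 / q ^ (2 * j + 1) - 1) * newton_prod j y"
proof -
  define a where "a = q ^ j"
  have a: "a \<noteq> 0" "q ^ (2 * j + 1) = q * a * a"
    by (simp_all add: a_def mult_2 power_add)
  have id: "(1 - q * y) * (P * (1 - q * a * y) / (q * a * y)) + (1 - y) * (P * (1 - y / a) / y)
     = (1 + 1 / (q * a)) * (P * (1 - y / a) / y * (1 - q * a * y)) + (1 - q * a) * (1 / (q * a * a) - 1) * P" for P
    using assms a(1) by (simp add: field_simps)
  show ?thesis
    unfolding centred_prod_up[OF assms] newton_prod.simps(2) a(2) power_Suc
    unfolding centred_prod_def a_def[symmetric] by (rule id)
qed

text \<open>At \<open>y = q^n\<close> the factor \<open>1 + qy\<close> is the factor \<open>1 + q^(n+1)\<close> of the system for \<open>U\<close> and \<open>V\<close>. What remains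
  involves only two adjacent centred products, hence the coefficients obey a two-term recurrence.\<close>

lemma centred_prod_diff:
  assumes "y \<noteq> 0"
  shows "(1 - q * (q * y)) * centred_prod (Suc j) (q * (q * y)) - (1 - y) * centred_prod (Suc j) y
       = (1 + q * y) * (1 - q ^ (j + 2)) *
           ((1 + 1 / q ^ (j + 2)) * centred_prod (Suc j) (q * y)
            + (1 - q ^ Suc j) * (1 / q ^ (2 * j + 3) - 1) * centred_prod j (q * y))"
proof -
  define a where "a = q ^ j"
  define R where "R = centred_prod j (q * y)"
  have qy: "q * y \<noteq> 0" using assms by simp
  have a: "a \<noteq> 0" "q ^ (2 * j + 3) = q * q * q * a * a" "q ^ (j + 2) = q * q * a"
    unfolding a_def numeral_3_eq_3 numeral_2_eq_2
    by (simp_all add: power_add mult_ac)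
  have up: "centred_prod (Suc j) (q * (q * y))
      = R * (1 - q * a * (q * y)) * (1 - q * (q * a) * (q * y)) / (q * (q * a) * (q * y))"
    unfolding centred_prod_up[OF qy] newton_prod_Suc_centred R_def a_def power_Suc ..
  have down: "centred_prod (Suc j) y = R * (q * a - q * y) * (1 - y / (q * a)) / y"
    unfolding centred_prod_def[of "Suc j"] newton_prod_down[OF assms] R_def[symmetric]
    by (simp add: a_def)
  show ?thesis
    unfolding up down a(2,3) centred_prod_Suc[of j "q * y"] R_def[symmetric] power_Suc a_def[symmetric]
    by (rule centred_prod_diff_identity) (use assms a(1) in simp_all)
qed

section \<open>Expansion of the squares and mixed products\<close>

text \<open>The coefficients of \<open>U\<close> with \<open>x = q^m\<close>, indexed so that \<open>j = 0\<close> is the first centred product. The initial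
  value makes \<open>U\<^sub>0 = 1\<close>; the ratio is forced by \<open>square_mixed_balance\<close>. The factor \<open>1 - x / q^(j+1)\<close>
  vanishes at \<open>j + 1 = m\<close> and so ends the expansion there.\<close>

primrec square_coeff :: "'a \<Rightarrow> nat \<Rightarrow> 'a" where
  "square_coeff x 0 = q / (1 - q)\<^sup>2"
| "square_coeff x (Suc j) = square_coeff x j *
     ((1 + q ^ Suc j) * q ^ (2 * j + 3) * (1 - x / q ^ Suc j) * (1 - x * q ^ Suc j)
      / (x * (1 - q ^ (2 * j + 3)) * (1 - q ^ (j + 2)) * (1 - q ^ Suc j)\<^sup>2))"

definition mixed_coeff :: "'a \<Rightarrow> nat \<Rightarrow> 'a" where
  "mixed_coeff x j = square_coeff x j * (1 - x) / (x * (1 - q ^ Suc j))"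

lemma square_coeff_vanish: "x = q ^ Suc m \<Longrightarrow> square_coeff x (Suc m) = 0"
  by simp

lemma square_coeff_step:
  assumes "x \<noteq> 0"
  shows "square_coeff x (Suc j) * ((1 - q ^ (j + 2)) * (1 - q ^ Suc j) * (1 / q ^ (2 * j + 3) - 1))
       = square_coeff x j * ((1 + q ^ Suc j) * (1 - x / q ^ Suc j) * (1 - x * q ^ Suc j) / (x * (1 - q ^ Suc j)))"
proof -
  have nz: "1 - q ^ (2 * j + 3) \<noteq> 0" "1 - q ^ (j + 2) \<noteq> 0" "1 - q ^ Suc j \<noteq> 0"
    by (rule one_minus_power_nonzero, simp)+
  have *: "1 / q ^ (2 * j + 3) - 1 = (1 - q ^ (2 * j + 3)) / q ^ (2 * j + 3)"
    by (simp add: field_simps)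
  have id: "w * ((1 + c) * e * N * N' / (x * A * B * C\<^sup>2)) * (B * C * (A / e)) = w * ((1 + c) * N * N' / (x * C))"
    if "A \<noteq> 0" "B \<noteq> 0" "C \<noteq> 0" "e \<noteq> 0" for w c e N N' A B C
    using that assms by (simp add: power2_eq_square)
  show ?thesis
    unfolding square_coeff.simps * by (rule id[OF nz]) simp
qed

text \<open>Comparison of coefficients of the centred products in the equation for \<open>U\<^bsub>n+1\<^esub> - U\<^bsub>n-1\<^esub>\<close>.\<close>

lemma square_mixed_balance:
  assumes "x \<noteq> 0"
  shows "square_coeff x j * ((1 - q ^ Suc j) * (1 + 1 / q ^ Suc j))
           + square_coeff x (Suc j) * ((1 - q ^ (j + 2)) * (1 - q ^ Suc j) * (1 / q ^ (2 * j + 3) - 1))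
       = (1 - x) * (1 + q ^ Suc j) * mixed_coeff x j"
proof -
  define a where "a = q ^ Suc j"
  have a: "a \<noteq> 0" "1 - a \<noteq> 0" unfolding a_def by (simp, rule one_minus_power_Suc_nonzero)
  have id: "w * ((1 - a) * (1 + 1 / a)) + w * ((1 + a) * (1 - x / a) * (1 - x * a) / (x * (1 - a)))
      = (1 - x) * (1 + a) * (w * (1 - x) / (x * (1 - a)))" for w
    using a assms by (simp add: field_simps)
  show ?thesis
    unfolding square_coeff_step[OF assms] mixed_coeff_def
    unfolding a_def[symmetric] by (rule id)
qed

text \<open>The quantities \<open>U\<^bsub>n-1\<^esub>\<close> and \<open>V\<^sub>n\<close>. The index of \<open>U\<close> is moved by one to make room for
  \<open>U\<^bsub>-1\<^esub> = 0\<close>, so that the two recurrences below hold from \<open>n = 0\<close> on.\<close>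

definition square_term :: "nat \<Rightarrow> nat \<Rightarrow> 'a" where
  "square_term m n = (case n of 0 \<Rightarrow> 0 | Suc k \<Rightarrow> (companion m k)\<^sup>2 / q ^ (m * k))"

definition mixed_term :: "nat \<Rightarrow> nat \<Rightarrow> 'a" where
  "mixed_term m n = (case n of 0 \<Rightarrow> 0 | Suc k \<Rightarrow> companion m (Suc k) * companion m k / q ^ (m * Suc k))"

lemma mixed_term_step:
  assumes "m \<ge> 1"
  shows "q ^ m * (1 - q ^ Suc n) * (mixed_term m (Suc n) - mixed_term m n)
       = (1 - q ^ m) * (1 + q ^ Suc n) * square_term m (Suc n)"
proof (cases n)
  case 0
  then show ?thesis
    using companion_recurrence(1)[OF assms] companion_0[of m]
    by (simp add: mixed_term_def square_term_def)
next
  case (Suc k)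
  define x y where "x = q ^ m" and "y = q ^ (m * k)"
  have nz: "x \<noteq> 0" "y \<noteq> 0" by (simp_all add: x_def y_def)
  have pw: "q ^ (m * Suc k) = x * y" "q ^ (m * Suc (Suc k)) = x * x * y"
    by (simp_all add: x_def y_def power_add)
  have rec: "(1 - q ^ (k + 2)) * (companion m (k + 2) - x * companion m k)
      = (1 - x) * (1 + q ^ (k + 2)) * companion m (k + 1)"
    unfolding x_def by (rule companion_recurrence(2)[OF assms])
  have id: "x * t * (g2 * g1 / (x * x * y) - g1 * g0 / (x * y)) = t * (g2 - x * g0) * g1 / (x * y)" for t g0 g1 g2
    using nz by (simp add: field_simps)
  have "x * (1 - q ^ (k + 2)) * (companion m (k + 2) * companion m (k + 1) / (x * x * y)
           - companion m (k + 1) * companion m k / (x * y))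
      = (1 - x) * (1 + q ^ (k + 2)) * ((companion m (k + 1))\<^sup>2 / (x * y))"
    unfolding id rec by (simp add: power2_eq_square)
  then show ?thesis
    unfolding Suc mixed_term_def square_term_def x_def[symmetric] by (simp add: pw del: mult_Suc_right)
qed

text \<open>Multiply the recurrence for \<open>G\<^bsub>n+1\<^esub> - q^m G\<^bsub>n-1\<^esub>\<close> by \<open>G\<^bsub>n+1\<^esub> + q^m G\<^bsub>n-1\<^esub>\<close>: the left side is a
  difference of squares and the right side a sum of two mixed products.\<close>

lemma square_term_step:
  assumes "m \<ge> 1"
  shows "(1 - q ^ Suc n) * (square_term m (Suc (Suc n)) - square_term m n)
       = (1 - q ^ m) * (1 + q ^ Suc n) * (mixed_term m (Suc n) + mixed_term m n)"
proof (cases n)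
  case 0
  have rec: "(1 - q) * companion m 1 = (1 - q ^ m) * (1 + q)"
    by (rule companion_recurrence(1)[OF assms])
  have "(1 - q) * (companion m 1)\<^sup>2 = (1 - q ^ m) * (1 + q) * companion m 1"
    unfolding rec[symmetric] by (simp add: power2_eq_square)
  then show ?thesis
    using companion_0[of m] by (simp add: 0 mixed_term_def square_term_def)
next
  case (Suc k)
  define x y where "x = q ^ m" and "y = q ^ (m * k)"
  have nz: "x \<noteq> 0" "y \<noteq> 0" by (simp_all add: x_def y_def)
  have pw: "q ^ (m * Suc k) = x * y" "q ^ (m * Suc (Suc k)) = x * x * y"
    by (simp_all add: x_def y_def power_add)
  have rec: "(1 - q ^ (k + 2)) * (companion m (k + 2) - x * companion m k)
      = (1 - x) * (1 + q ^ (k + 2)) * companion m (k + 1)"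
    unfolding x_def by (rule companion_recurrence(2)[OF assms])
  have id: "t * (g2\<^sup>2 / (x * x * y) - g0\<^sup>2 / y) = t * (g2 - x * g0) * (g2 + x * g0) / (x * x * y)" for t g0 g2
    using nz by (simp add: field_simps power2_eq_square)
  have "(1 - q ^ (k + 2)) * ((companion m (k + 2))\<^sup>2 / (x * x * y) - (companion m k)\<^sup>2 / y)
      = (1 - x) * (1 + q ^ (k + 2)) * (companion m (k + 2) * companion m (k + 1) / (x * x * y)
           + companion m (k + 1) * companion m k / (x * y))"
    unfolding id rec using nz by (simp add: field_simps)
  then show ?thesis
    unfolding Suc mixed_term_def square_term_def x_def[symmetric] by (simp add: pw y_def[symmetric] del: mult_Suc_right)
qed

text \<open>The difference of \<open>V\<close> involves one value of \<open>U\<close>, and the two-step difference of \<open>U\<close> involves two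
  values of \<open>V\<close>; therefore the induction carries \<open>V\<^sub>n\<close> and two consecutive values of \<open>U\<close>.\<close>

lemma square_mixed_expansion:
  assumes "m \<ge> 1"
  shows "mixed_term m n = (\<Sum>j<m. mixed_coeff (q ^ m) j * newton_prod (Suc j) (q ^ n))
       \<and> square_term m n = (\<Sum>j<m. square_coeff (q ^ m) j * ((1 - q ^ n) * centred_prod j (q ^ n)))
       \<and> square_term m (Suc n)
           = (\<Sum>j<m. square_coeff (q ^ m) j * ((1 - q ^ Suc n) * centred_prod j (q ^ Suc n)))"
proof (induction n)
  case 0
  have "(\<Sum>j<m. square_coeff (q ^ m) j * ((1 - q) * centred_prod j q))
      = (\<Sum>j<m. if j = 0 then 1 else 0)"
    using one_minus_power_nonzero[of 1]
    by (intro sum.cong) (auto simp: centred_prod_at_base power2_eq_square)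
  also have "\<dots> = 1"
    using assms by simp
  finally show ?case
    using companion_0[of m] by (simp add: mixed_term_def square_term_def del: newton_prod.simps(2))
next
  case (Suc n)
  define x y where "x = q ^ m" and "y = q ^ n"
  obtain M where M: "m = Suc M" using assms by (cases m) auto
  let ?w = "square_coeff x" and ?v = "mixed_coeff x"
  have nz: "x \<noteq> 0" "y \<noteq> 0" "1 - q * y \<noteq> 0"
    using one_minus_power_Suc_nonzero[of n] by (simp_all add: x_def y_def)
  have V: "mixed_term m n = (\<Sum>j<m. ?v j * newton_prod (Suc j) y)"
    and U: "square_term m n = (\<Sum>j<m. ?w j * ((1 - y) * centred_prod j y))"
    and U': "square_term m (Suc n) = (\<Sum>j<m. ?w j * ((1 - q * y) * centred_prod j (q * y)))"
    using Suc.IH by (simp_all only: x_def y_def power_Suc)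
  have "x * (1 - q * y) * (mixed_term m (Suc n) - mixed_term m n)
      = (1 - x) * (1 + q * y) * square_term m (Suc n)"
    using mixed_term_step[OF assms, of n] by (simp add: x_def y_def)
  also have "\<dots> = (\<Sum>j<m. x * (1 - q * y) * (?v j * (newton_prod (Suc j) (q * y) - newton_prod (Suc j) y)))"
    unfolding U' sum_distrib_left
  proof (rule sum.cong)
    fix j
    have "1 - q ^ Suc j \<noteq> 0" by (rule one_minus_power_Suc_nonzero)
    then show "(1 - x) * (1 + q * y) * (?w j * ((1 - q * y) * centred_prod j (q * y)))
        = x * (1 - q * y) * (?v j * (newton_prod (Suc j) (q * y) - newton_prod (Suc j) y))"
      unfolding newton_prod_diff[OF nz(2)] mixed_coeff_def using nz(1) by (simp add: mult_ac del: power_Suc)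
  qed simp
  finally have "mixed_term m (Suc n) - mixed_term m n
      = (\<Sum>j<m. ?v j * (newton_prod (Suc j) (q * y) - newton_prod (Suc j) y))"
    unfolding sum_distrib_left[symmetric] using nz by (simp del: newton_prod.simps(2))
  then have V': "mixed_term m (Suc n) = (\<Sum>j<m. ?v j * newton_prod (Suc j) (q * y))"
    unfolding V by (simp only: right_diff_distrib sum_subtractf diff_add_cancel diff_eq_eq)
  \<comment> \<open>contributions to the \<open>j\<close>-th centred product of the \<open>j\<close>-th and of the next square coefficient\<close>
  define f where "f j = ?w j * ((1 - q ^ Suc j) * (1 + 1 / q ^ Suc j)) * centred_prod j (q * y)" for j
  define h where "h j = ?w (Suc j) * ((1 - q ^ (j + 2)) * (1 - q ^ Suc j) * (1 / q ^ (2 * j + 3) - 1)) * centred_prod j (q * y)" for j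
  have diff0: "?w 0 * ((1 - q * (q * y)) * centred_prod 0 (q * (q * y))) - ?w 0 * ((1 - y) * centred_prod 0 y)
      = (1 + q * y) * f 0"
  proof -
    have "(1 - q * (q * y)) * centred_prod 0 (q * (q * y)) - (1 - y) * centred_prod 0 y
       = (1 + q * y) * ((1 - q) * (1 + 1 / q) * centred_prod 0 (q * y))"
      using nz by (simp add: centred_prod_def field_simps)
    then show ?thesis
      unfolding f_def by (simp only: right_diff_distrib[symmetric]) (simp add: mult_ac)
  qed
  have diffSuc: "?w (Suc j) * ((1 - q * (q * y)) * centred_prod (Suc j) (q * (q * y)))
        - ?w (Suc j) * ((1 - y) * centred_prod (Suc j) y) = (1 + q * y) * (f (Suc j) + h j)" for j
    unfolding right_diff_distrib[symmetric] centred_prod_diff[OF nz(2)] f_def h_def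
    by (simp only: add_2_eq_Suc' distrib_left mult_ac)
  have "(1 - q * y) * (square_term m (Suc (Suc n)) - square_term m n)
      = (1 - x) * (1 + q * y) * (mixed_term m (Suc n) + mixed_term m n)"
    using square_term_step[OF assms, of n] by (simp add: x_def y_def)
  also have "\<dots> = (1 - x) * (1 + q * y) * (\<Sum>j<m. ?v j * ((1 + q ^ Suc j) * (1 - q * y) * centred_prod j (q * y)))"
    unfolding V V' newton_prod_sum[OF nz(2), symmetric]
    by (simp only: distrib_left sum.distrib)
  also have "\<dots> = (1 - q * y) * ((1 + q * y) * (\<Sum>j<m. (1 - x) * (1 + q ^ Suc j) * ?v j * centred_prod j (q * y)))"
    unfolding sum_distrib_left by (intro sum.cong) (simp_all only: mult_ac)
  also have "(\<Sum>j<m. (1 - x) * (1 + q ^ Suc j) * ?v j * centred_prod j (q * y)) = (\<Sum>j<m. f j + h j)"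
    unfolding square_mixed_balance[OF nz(1), symmetric] f_def h_def by (simp only: distrib_right)
  also have "\<dots> = f 0 + (\<Sum>j<M. f (Suc j)) + (\<Sum>j<M. h j)"
  proof -
    have "h M = 0"
      unfolding h_def by (subst square_coeff_vanish[of _ M]) (simp_all add: x_def M)
    then show ?thesis
      unfolding M sum.distrib by (subst sum.lessThan_Suc_shift) simp
  qed
  also have "(1 + q * y) * \<dots> = (\<Sum>j<m. ?w j * ((1 - q * (q * y)) * centred_prod j (q * (q * y)))
       - ?w j * ((1 - y) * centred_prod j y))"
    unfolding M sum.lessThan_Suc_shift[of _ M] diff0 diffSuc
    by (simp only: distrib_left sum_distrib_left sum.distrib add.assoc)
  finally have "square_term m (Suc (Suc n)) - square_term m n = \<dots>"
    by (simp only: mult_cancel_left nz(3) simp_thms)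
  then have U'': "square_term m (Suc (Suc n))
      = (\<Sum>j<m. ?w j * ((1 - q * (q * y)) * centred_prod j (q * (q * y))))"
    unfolding U sum_subtractf by (simp only: diff_eq_eq diff_add_cancel)
  show ?case
    using V' U' U'' by (simp only: x_def y_def power_Suc)
qed

section \<open>The product of the two q-Delannoy numbers\<close>

lemma central_qbinom_step:
  "(1 - q ^ (2 * j + 1)) * (1 - q ^ (2 * j + 2)) * qbinom q (m + j + 1) (2 * j + 2)
     = (1 - q ^ m / q ^ j) * (1 - q ^ (m + j + 1)) * qbinom q (m + j) (2 * j)"
proof -
  have *: "(1 - q ^ (m + j - 2 * j)) * qbinom q (m + j) (2 * j) = (1 - q ^ m / q ^ j) * qbinom q (m + j) (2 * j)"
  proof (cases "j \<le> m")
    case True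
    then have "q ^ (m + j - 2 * j) = q ^ m / q ^ j"
      by (simp add: power_diff mult_2)
    then show ?thesis by simp
  qed (simp add: qbinom_eq_0)
  have up: "(1 - q ^ (2 * j + 2)) * qbinom q (m + j + 1) (2 * j + 2) = (1 - q ^ (m + j + 1)) * qbinom q (m + j) (2 * j + 1)"
    using qbinom_Suc_Suc[of "2 * j + 1" "m + j"] by simp
  have low: "(1 - q ^ (2 * j + 1)) * qbinom q (m + j) (2 * j + 1) = (1 - q ^ (m + j - 2 * j)) * qbinom q (m + j) (2 * j)"
    using qbinom_Suc_lower[of "2 * j" "m + j"] by simp
  have "(1 - q ^ (2 * j + 1)) * (1 - q ^ (2 * j + 2)) * qbinom q (m + j + 1) (2 * j + 2)
      = (1 - q ^ (m + j + 1)) * ((1 - q ^ (2 * j + 1)) * qbinom q (m + j) (2 * j + 1))"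
    unfolding mult.assoc up by (simp only: mult_ac)
  then show ?thesis
    unfolding low * by (simp only: mult_ac)
qed

text \<open>The product \<open>(-1;q)\<^sub>j (-q;q)\<^sub>j\<close>, which is \<open>4^j\<close> at \<open>q = 1\<close>.\<close>

definition doubling_factor :: "nat \<Rightarrow> 'a" where
  "doubling_factor j = (\<Prod>i<j. (1 + q ^ i) * (1 + q ^ Suc i))"

definition delannoy_coeff :: "nat \<Rightarrow> nat \<Rightarrow> 'a" where
  "delannoy_coeff m j = q ^ (j * j) / q ^ (m * j) * doubling_factor j * qbinom q (m + j) (2 * j)"

definition newton_basis :: "nat \<Rightarrow> nat \<Rightarrow> 'a" where
  "newton_basis j k = newton_prod j (q ^ k) / (qpoch q q j)\<^sup>2"

lemma delannoy_coeff_0 [simp]: "delannoy_coeff m 0 = 1"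
  by (simp add: delannoy_coeff_def doubling_factor_def)

lemma delannoy_coeff_Suc:
  "(1 - q ^ (2 * j + 1)) * (1 - q ^ Suc j) * delannoy_coeff m (Suc j)
    = delannoy_coeff m j * (1 + q ^ j) * q ^ (2 * j + 1) / q ^ m
        * (1 - q ^ m / q ^ j) * (1 - q ^ m * q ^ Suc j)"
proof -
  have e: "Suc j * Suc j = j * j + (2 * j + 1)" by simp
  have f: "1 - q ^ (2 * j + 2) = (1 - q ^ Suc j) * (1 + q ^ Suc j)"
    by (simp add: algebra_simps power_add mult_2 mult_2_right)
  have "(1 - q ^ (2 * j + 1)) * (1 - q ^ Suc j) * delannoy_coeff m (Suc j)
      = q ^ (j * j) * q ^ (2 * j + 1) / (q ^ (m * j) * q ^ m) * doubling_factor j * (1 + q ^ j)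
        * ((1 - q ^ (2 * j + 1)) * (1 - q ^ (2 * j + 2)) * qbinom q (m + j + 1) (2 * j + 2))"
    unfolding delannoy_coeff_def e f doubling_factor_def prod.lessThan_Suc
    by (simp add: power_add mult_ac)
  also have "\<dots> = delannoy_coeff m j * (1 + q ^ j) * q ^ (2 * j + 1) / q ^ m
        * (1 - q ^ m / q ^ j) * (1 - q ^ m * q ^ Suc j)"
    unfolding central_qbinom_step delannoy_coeff_def
    by (simp add: power_add mult_ac)
  finally show ?thesis .
qed

text \<open>Links the explicit coefficients to the recursively defined ones: both sides have the same ratio of
  consecutive terms.\<close>

lemma delannoy_coeff_square_coeff:
  fixes m j :: nat
  defines "x \<equiv> q ^ m"
  shows "delannoy_coeff m (Suc j)
    = (qpoch q q (Suc j))\<^sup>2 *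
       (2 * square_coeff x j * (1 - x) * (1 - x * q ^ Suc j) / (x * (1 - q ^ Suc j)\<^sup>2))"
proof (induction j)
  case 0
  have nz: "1 - q \<noteq> 0" using one_minus_power_nonzero[of 1] by simp
  have "(1 - q) * (1 - q) * delannoy_coeff m 1 = 2 * q / x * (1 - x) * (1 - x * q)"
    using delannoy_coeff_Suc[of 0 m] by (simp add: x_def)
  then have "delannoy_coeff m 1 = 2 * q / x * (1 - x) * (1 - x * q) / ((1 - q) * (1 - q))"
    by (rule eq_divideI[rotated]) (use nz in simp)
  then show ?case
    using nz by (simp add: qpoch_Suc power2_eq_square)
next
  case (Suc j)
  define A where "A = q ^ Suc j"
  have nz: "1 - q ^ (2 * j + 3) \<noteq> 0" "1 - q * A \<noteq> 0" "1 - A \<noteq> 0"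
    using one_minus_power_nonzero[of "2 * j + 3"] one_minus_power_Suc_nonzero[of j]
      one_minus_power_Suc_nonzero[of "Suc j"] by (simp_all add: A_def del: power_Suc add: power_Suc[of _ "Suc j"])
  have x: "x \<noteq> 0" by (simp add: x_def)
  have "(1 - q ^ (2 * j + 3)) * (1 - q * A) * delannoy_coeff m (Suc (Suc j))
    = delannoy_coeff m (Suc j) * (1 + A) * q ^ (2 * j + 3) / x * (1 - x / A) * (1 - x * (q * A))"
    using delannoy_coeff_Suc[of "Suc j" m] by (simp add: A_def x_def numeral_3_eq_3)
  then have rec: "delannoy_coeff m (Suc (Suc j))
    = delannoy_coeff m (Suc j) * (1 + A) * q ^ (2 * j + 3) / x * (1 - x / A) * (1 - x * (q * A))
        / ((1 - q ^ (2 * j + 3)) * (1 - q * A))"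
    by (rule eq_divideI[rotated]) (use nz in simp)
  have id: "P\<^sup>2 * (d * w * (1 - x) * (1 - x * A) / (x * (1 - A)\<^sup>2)) * (1 + A) * Q / x * (1 - x / A) * (1 - x * (q * A))
        / (R * (1 - q * A))
     = (P * (1 - q * A))\<^sup>2 * (d * (w * ((1 + A) * Q * (1 - x / A) * (1 - x * A) / (x * R * (1 - q * A) * (1 - A)\<^sup>2)))
         * (1 - x) * (1 - x * (q * A)) / (x * (1 - q * A)\<^sup>2))" for P w Q R d
    using nz(2) by (simp add: power_mult_distrib power2_eq_square mult_ac)
  show ?case
    unfolding rec Suc.IH qpoch_Suc[of "Suc j"] square_coeff.simps add_2_eq_Suc' power_Suc[of q "Suc j"] A_def[symmetric]
    by (rule id)
qed

lemma qDelannoy_product_square_mixed: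
  assumes "m \<ge> 1"
  shows "qDelannoy q m n * qDelannoy (inverse q) m n
       = square_term m (Suc n) + square_term m n + (1 + q ^ m) * mixed_term m n"
proof (cases n)
  case 0
  then show ?thesis
    using qDelannoy_companion(3,4)[OF assms] companion_0[of m]
    by (simp add: square_term_def mixed_term_def)
next
  case (Suc k)
  define x y where "x = q ^ m" and "y = q ^ (m * k)"
  have nz: "x \<noteq> 0" "y \<noteq> 0" by (simp_all add: x_def y_def)
  have pw: "q ^ (m * Suc k) = x * y" by (simp add: x_def y_def power_add)
  have "qDelannoy (inverse q) m n = (companion m n + x * companion m k) / (x * y)"
    using qDelannoy_companion(2)[OF assms, of k] nz unfolding Suc pw x_def[symmetric]
    by (simp add: field_simps)
  moreover have "(g1 + g0) * ((g1 + x * g0) / (x * y))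
      = g1\<^sup>2 / (x * y) + g0\<^sup>2 / y + (1 + x) * (g1 * g0 / (x * y))" for g0 g1
    using nz by (simp add: field_simps power2_eq_square)
  ultimately show ?thesis
    unfolding qDelannoy_companion(1)[OF assms, of k, folded Suc]
    by (simp only: Suc square_term_def mixed_term_def nat.case pw x_def[symmetric] y_def[symmetric])
qed

text \<open>Each Newton product collects the two parts of \<open>U\<^sub>n + U\<^bsub>n-1\<^esub>\<close> coming from adjacent centred products and
  one part of \<open>(1 + q^m) V\<^sub>n\<close>; the constant term comes from the first centred product alone.\<close>

lemma qDelannoy_product:
  assumes "m \<ge> 1"
  shows "qDelannoy q m n * qDelannoy (inverse q) m n = (\<Sum>j\<le>m. delannoy_coeff m j * newton_basis j n)"
proof -
  define x y where "x = q ^ m" and "y = q ^ n"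
  let ?w = "square_coeff x" and ?v = "mixed_coeff x" and ?P = "\<lambda>j. newton_prod j y"
  obtain M where M: "m = Suc M" using assms by (cases m) auto
  have nz: "x \<noteq> 0" "y \<noteq> 0" by (simp_all add: x_def y_def)
  define h where "h j = ?w j * ((1 - q ^ Suc j) * (1 / q ^ (2 * j + 1) - 1)) * ?P j" for j
  have w: "?w m = 0" unfolding M by (rule square_coeff_vanish) (simp add: x_def M)
  have h0: "h 0 = 1"
  proof -
    have "1 - q \<noteq> 0" using one_minus_power_nonzero[of 1] by simp
    moreover have "1 / q - 1 = (1 - q) / q"
      by (simp add: field_simps)
    ultimately show ?thesis by (simp add: h_def power2_eq_square)
  qed
  have coeff: "?w j * (1 + 1 / q ^ Suc j) * ?P (Suc j) + h (Suc j) + (1 + x) * (?v j * ?P (Suc j))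
      = delannoy_coeff m (Suc j) * newton_basis (Suc j) n" for j
  proof -
    define a where "a = q ^ Suc j"
    have a: "a \<noteq> 0" "1 - a \<noteq> 0" unfolding a_def by (simp, rule one_minus_power_Suc_nonzero)
    have "?w (Suc j) * ((1 - q ^ (j + 2)) * (1 / q ^ (2 * j + 3) - 1)) * (1 - a)
        = ?w j * ((1 + a) * (1 - x / a) * (1 - x * a) / (x * (1 - a)))"
      using square_coeff_step[OF nz(1), of j] by (simp only: a_def mult_ac)
    then have step: "?w (Suc j) * ((1 - q ^ (j + 2)) * (1 / q ^ (2 * j + 3) - 1))
        = ?w j * ((1 + a) * (1 - x / a) * (1 - x * a) / (x * (1 - a))) / (1 - a)"
      using a(2) by (simp only: eq_divide_eq) simp
    have id: "w * (1 + 1 / a) + w * ((1 + a) * (1 - x / a) * (1 - x * a) / (x * (1 - a))) / (1 - a)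
          + (1 + x) * (w * (1 - x) / (x * (1 - a)))
        = 2 * w * (1 - x) * (1 - x * a) / (x * (1 - a)\<^sup>2)" for w
      by (rule delannoy_coeff_balance[OF nz(1) a(1) a(2) refl])
    have "h (Suc j) = ?w (Suc j) * ((1 - q ^ (j + 2)) * (1 / q ^ (2 * j + 3) - 1)) * ?P (Suc j)"
      by (simp add: h_def numeral_3_eq_3)
    then have "?w j * (1 + 1 / q ^ Suc j) * ?P (Suc j) + h (Suc j) + (1 + x) * (?v j * ?P (Suc j))
       = (2 * ?w j * (1 - x) * (1 - x * a) / (x * (1 - a)\<^sup>2)) * ?P (Suc j)"
      unfolding step id[symmetric] mixed_coeff_def a_def[symmetric] by (simp only: algebra_simps)
    also have "\<dots> = delannoy_coeff m (Suc j) * newton_basis (Suc j) n"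
      unfolding newton_basis_def delannoy_coeff_square_coeff x_def[symmetric] y_def[symmetric] a_def[symmetric]
      by (simp add: mult_ac)
    finally show ?thesis .
  qed
  have "qDelannoy q m n * qDelannoy (inverse q) m n
      = (\<Sum>j<m. ?w j * ((1 - q * y) * centred_prod j (q * y) + (1 - y) * centred_prod j y))
        + (\<Sum>j<m. (1 + x) * (?v j * ?P (Suc j)))"
    using square_mixed_expansion[OF assms, of n] unfolding qDelannoy_product_square_mixed[OF assms]
    by (simp only: x_def y_def power_Suc distrib_left sum.distrib sum_distrib_left)
  also have "(\<Sum>j<m. ?w j * ((1 - q * y) * centred_prod j (q * y) + (1 - y) * centred_prod j y))
      = (\<Sum>j<m. ?w j * (1 + 1 / q ^ Suc j) * ?P (Suc j)) + (\<Sum>j<m. h j)"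
    unfolding centred_prod_sum[OF nz(2)] h_def by (simp only: mult.assoc distrib_left[of _ "_ * _"] sum.distrib)
  \<comment> \<open>the added term vanishes because the square coefficients end at \<open>m\<close>\<close>
  also have "(\<Sum>j<m. h j) = (\<Sum>j<Suc m. h j)"
    using w by (simp add: h_def)
  also have "\<dots> = 1 + (\<Sum>j<m. h (Suc j))"
    unfolding sum.lessThan_Suc_shift h0 ..
  finally have "qDelannoy q m n * qDelannoy (inverse q) m n
      = 1 + (\<Sum>j<m. ?w j * (1 + 1 / q ^ Suc j) * ?P (Suc j) + h (Suc j) + (1 + x) * (?v j * ?P (Suc j)))"
    by (simp only: sum.distrib ac_simps)
  also have "\<dots> = (\<Sum>j<Suc m. delannoy_coeff m j * newton_basis j n)"
    unfolding coeff sum.lessThan_Suc_shift by (simp add: newton_basis_def)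
  finally show ?thesis
    by (simp only: lessThan_Suc_atMost)
qed

section \<open>Telescoping sums\<close>

lemma centred_prod_qbinom:
  "centred_prod j (q ^ Suc n)
     = (qpoch q q j)\<^sup>2 * (1 - q ^ Suc n) * qbinom q (Suc n + j) j * qbinom q n j / q ^ (Suc n * Suc j)"
proof (induction j)
  case 0
  show ?case by (simp add: centred_prod_def)
next
  case (Suc j)
  define Y where "Y = q ^ Suc n"
  have lower: "(1 - q ^ Suc j) * qbinom q n (Suc j) = qbinom q n j * (1 - Y / q ^ Suc j)"
  proof (cases "j \<le> n")
    case True
    then have "q ^ (n - j) = Y / q ^ Suc j"
      by (simp add: power_diff Y_def)
    then show ?thesis unfolding qbinom_Suc_lower by (simp add: mult_ac)
  qed (simp add: qbinom_eq_0)
  have upper: "(1 - q ^ Suc j) * qbinom q (Suc n + Suc j) (Suc j) = (1 - q ^ Suc j * Y) * qbinom q (Suc n + j) j"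
    using qbinom_Suc_Suc[of j "Suc n + j"] by (simp add: Y_def power_add mult_ac)
  have "(qpoch q q (Suc j))\<^sup>2 * (1 - Y) * qbinom q (Suc n + Suc j) (Suc j) * qbinom q n (Suc j) / q ^ (Suc n * Suc (Suc j))
     = (qpoch q q j)\<^sup>2 * (1 - Y) * ((1 - q ^ Suc j) * qbinom q (Suc n + Suc j) (Suc j)) * ((1 - q ^ Suc j) * qbinom q n (Suc j))
         / q ^ (Suc n * Suc j) / Y"
    unfolding qpoch_Suc Y_def by (simp add: power2_eq_square power_add mult_ac)
  also have "\<dots> = ((qpoch q q j)\<^sup>2 * (1 - Y) * qbinom q (Suc n + j) j * qbinom q n j / q ^ (Suc n * Suc j))
       * (1 - q ^ Suc j * Y) * (1 - Y / q ^ Suc j) / Y"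
    unfolding lower upper by (simp only: times_divide_eq_left times_divide_eq_right mult_ac)
  also have "\<dots> = centred_prod (Suc j) Y"
    unfolding centred_prod_Suc Suc.IH[folded Y_def] ..
  finally show ?case by (simp only: Y_def)
qed

text \<open>The weight \<open>(1 - q^(2k+1)) / q^k\<close> is, up to a constant, the factor that remains in the difference of
  \<open>(1 - y)\<close> times a centred product.\<close>

lemma newton_prod_telescope:
  "(\<Sum>k<n. (1 - q ^ (2 * k + 1)) / q ^ k * newton_prod j (q ^ k))
     = q ^ Suc j / (1 - q ^ Suc j) * ((1 - q ^ n) * centred_prod j (q ^ n))"
proof (induction n)
  case (Suc n)
  define a y P where "a = q ^ j" and "y = q ^ n" and "P = newton_prod j y"
  have nz: "a \<noteq> 0" "y \<noteq> 0" "1 - q * a \<noteq> 0"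
    using one_minus_power_Suc_nonzero[of j] by (simp_all add: a_def y_def)
  have y2: "q ^ (2 * n + 1) = q * y * y" by (simp add: y_def mult_2 power_add)
  have c: "q * a / (1 - q * a) * X = Y" if "q * a * X = (1 - q * a) * Y" for X Y
    using that nz(3) by (simp add: field_simps)
  have id: "q * a * ((1 - q * y) * (P * (1 - q * a * y) / (q * a * y)) - (1 - y) * (P * (1 - y / a) / y))
      = (1 - q * a) * ((1 - q * y * y) / y * P)"
    using nz(1,2) by (simp add: field_simps)
  have "q * a / (1 - q * a) * ((1 - q * y) * centred_prod j (q * y) - (1 - y) * centred_prod j y)
      = (1 - q * y * y) / y * P"
    unfolding centred_prod_up[OF nz(2)] unfolding centred_prod_def a_def[symmetric] P_def[symmetric] power_Suc
    by (rule c[OF id])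
  then show ?case
    by (simp only: sum.lessThan_Suc Suc.IH y2 P_def power_Suc y_def[symmetric] a_def[symmetric] right_diff_distrib)
       (simp add: algebra_simps)
qed simp

lemma newton_prod_alternating_telescope:
  "(\<Sum>k<n. (- 1) ^ k * (1 - q ^ (2 * k + 1)) * q ^ (k choose 2) * newton_prod j (q ^ k))
     = - ((- 1) ^ n * q ^ (n choose 2) * q ^ n * centred_prod j (q ^ n))"
proof (induction n)
  case (Suc n)
  define a y P where "a = q ^ j" and "y = q ^ n" and "P = newton_prod j y"
  have nz: "a \<noteq> 0" "y \<noteq> 0" by (simp_all add: a_def y_def)
  have y2: "q ^ (2 * n + 1) = q * y * y" by (simp add: y_def mult_2 power_add)
  have "(1 - q * y * y) * P = y * (q * y * centred_prod j (q * y)) + y * centred_prod j y"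
    unfolding centred_prod_up[OF nz(2)] unfolding centred_prod_def a_def[symmetric] P_def[symmetric] power_Suc
    using nz by (simp add: field_simps)
  then have step: "s * (1 - q * y * y) * t * P = s * t * (y * (q * y * centred_prod j (q * y)) + y * centred_prod j y)" for s t
    by (simp only: mult.assoc mult.left_commute[of _ t])
  show ?case
    unfolding sum.lessThan_Suc Suc.IH y2
    unfolding choose_2_Suc power_add power_Suc y_def[symmetric] P_def[symmetric] step
    by (simp add: algebra_simps)
qed simp

section \<open>Linearization of products of basis elements\<close>

definition linearization_coeff :: "nat \<Rightarrow> nat \<Rightarrow> nat \<Rightarrow> 'a" where
  "linearization_coeff i j s =
     qbinom q i s * qbinom q (i + j) i * qbinom q (j + s) i * (q ^ (s * (j + s)) / q ^ (i * (j + s)))"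

text \<open>The difference of the Newton nodes with indices \<open>t + 1\<close> and \<open>i + 1\<close>, that is, of
  \<open>q^(t+1) + q^(-t)\<close> and \<open>q^(i+1) + q^(-i)\<close>, in factored form.\<close>

definition node_gap :: "nat \<Rightarrow> nat \<Rightarrow> 'a" where
  "node_gap i t = (1 - q ^ (t + i + 1)) * (1 - q ^ t / q ^ i) / q ^ t"

lemma newton_basis_Suc:
  "(1 - q ^ Suc i)\<^sup>2 * newton_basis (Suc i) k
     = (1 - q ^ k / q ^ i) * (1 - q ^ Suc i * q ^ k) / q ^ k * newton_basis i k"
proof -
  have "1 - q ^ Suc i \<noteq> 0" by (rule one_minus_power_Suc_nonzero)
  then show ?thesis
    unfolding newton_basis_def newton_prod.simps qpoch_Suc power_mult_distrib
    by (simp add: mult_ac del: power_Suc)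
qed

text \<open>The linear factor that extends \<open>e\<^sub>i\<close> is the one that extends \<open>e\<^sub>t\<close> plus the gap between the
  nodes; so it acts on \<open>e\<^sub>t\<close> by a two-term rule.\<close>

lemma newton_basis_node_shift:
  "(1 - q ^ k / q ^ i) * (1 - q ^ Suc i * q ^ k) / q ^ k * newton_basis t k
     = (1 - q ^ Suc t)\<^sup>2 * newton_basis (Suc t) k + node_gap i t * newton_basis t k"
proof -
  define y a b where "y = q ^ k" and "a = q ^ i" and "b = q ^ t"
  have nz: "y \<noteq> 0" "a \<noteq> 0" "b \<noteq> 0" by (simp_all add: y_def a_def b_def)
  have id: "(1 - y / a) * (1 - q * a * y) / y = (1 - y / b) * (1 - q * b * y) / y + (1 - q * a * b) * (1 - b / a) / b"
    using nz by (simp add: field_simps)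
  have gap: "node_gap i t = (1 - q * a * b) * (1 - b / a) / b"
    by (simp add: node_gap_def a_def b_def power_add mult_ac)
  show ?thesis
    unfolding newton_basis_Suc gap
    unfolding power_Suc y_def[symmetric] a_def[symmetric] b_def[symmetric] id by (rule distrib_right)
qed

lemma linearization_coeff_0:
  "(1 - q ^ Suc i)\<^sup>2 * linearization_coeff (Suc i) j 0 = linearization_coeff i j 0 * node_gap i j"
proof -
  have b1: "(1 - q ^ Suc i) * qbinom q (Suc i + j) (Suc i) = (1 - q ^ (j + i + 1)) * qbinom q (i + j) i"
    using qbinom_Suc_Suc[of i "i + j"] by (simp add: add_ac)
  have b2: "(1 - q ^ Suc i) * qbinom q j (Suc i) = (1 - q ^ j / q ^ i) * qbinom q j i"
    unfolding qbinom_Suc_lower by (cases "i \<le> j") (simp_all add: power_diff qbinom_eq_0)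
  have "(1 - q ^ Suc i)\<^sup>2 * linearization_coeff (Suc i) j 0
      = ((1 - q ^ Suc i) * qbinom q (Suc i + j) (Suc i)) * ((1 - q ^ Suc i) * qbinom q j (Suc i)) / (q ^ j * q ^ (i * j))"
    by (simp add: linearization_coeff_def power2_eq_square power_add mult_ac)
  then show ?thesis
    unfolding b1 b2 by (simp add: linearization_coeff_def node_gap_def mult_ac)
qed

text \<open>After common factors are removed this is a combination of the two \<open>q\<close>-Pascal rules for
  \<open>[i+1, s+1]\<close>: one of them minus a power of \<open>q\<close> times the other.\<close>

lemma linearization_coeff_Suc:
  "(1 - q ^ Suc i)\<^sup>2 * linearization_coeff (Suc i) j (Suc s)
     = linearization_coeff i j s * (1 - q ^ Suc (j + s))\<^sup>2
       + linearization_coeff i j (Suc s) * node_gap i (j + Suc s)"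
proof -
  define t T where "t = Suc (j + s)" and "T = q ^ t"
  define I S where "I = q ^ i" and "S = q ^ s"
  define A where "A = qbinom q (i + j) i * (1 - T / I) * qbinom q t i"
  define F G where "F = q ^ (s * t)" and "G = q ^ (i * t)"
  have nz: "T \<noteq> 0" "I \<noteq> 0" "S \<noteq> 0" "F \<noteq> 0" "G \<noteq> 0"
    by (simp_all add: T_def I_def S_def F_def G_def)
  have b1: "(1 - q ^ Suc i) * qbinom q (Suc i + j) (Suc i) = (1 - I * q ^ Suc j) * qbinom q (i + j) i"
    using qbinom_Suc_Suc[of i "i + j"] by (simp add: I_def power_add mult_ac)
  have drop: "(1 - q ^ (t - i)) * qbinom q t i = (1 - T / I) * qbinom q t i"
    by (cases "i \<le> t") (simp_all add: T_def I_def power_diff qbinom_eq_0)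
  have b2: "(1 - q ^ Suc i) * qbinom q t (Suc i) = (1 - T / I) * qbinom q t i"
    unfolding qbinom_Suc_lower by (rule drop)
  have b3: "(1 - T) * qbinom q (j + s) i = (1 - T / I) * qbinom q t i"
    using qbinom_Suc_upper[of "j + s" i] drop by (simp add: t_def T_def)
  have pascal': "qbinom q (Suc i) (Suc s) = I / S * qbinom q i s + qbinom q i (Suc s)"
    unfolding qbinom_Pascal' by (cases "s \<le> i") (simp_all add: I_def S_def power_diff qbinom_eq_0)
  have pascal: "qbinom q (Suc i) (Suc s) = qbinom q i s + q * S * qbinom q i (Suc s)"
    unfolding qbinom_Pascal by (simp add: S_def)
  have T: "T = q ^ Suc j * S" by (simp add: T_def t_def S_def power_add)
  have key: "(1 - I * q ^ Suc j) * qbinom q (Suc i) (Suc s)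
      = I / S * (1 - T) * qbinom q i s + (1 - q * T * I) * qbinom q i (Suc s)"
  proof -
    have "(1 - I * q ^ Suc j) * qbinom q (Suc i) (Suc s)
        = (I / S * qbinom q i s + qbinom q i (Suc s)) - I * q ^ Suc j * (qbinom q i s + q * S * qbinom q i (Suc s))"
      unfolding pascal[symmetric] pascal'[symmetric] by (simp only: left_diff_distrib mult_1_left)
    also have "\<dots> = I / S * (1 - T) * qbinom q i s + (1 - q * T * I) * qbinom q i (Suc s)"
      unfolding T using nz(3) by (simp add: field_simps)
    finally show ?thesis .
  qed
  have js: "j + Suc s = t" "j + s = t - 1" by (simp_all add: t_def)
  have "(1 - q ^ Suc i)\<^sup>2 * linearization_coeff (Suc i) j (Suc s)
     = qbinom q (Suc i) (Suc s) * ((1 - q ^ Suc i) * qbinom q (Suc i + j) (Suc i)) * ((1 - q ^ Suc i) * qbinom q t (Suc i))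
        * (F * T / (G * T))"
    unfolding linearization_coeff_def js(1)
    by (simp add: power2_eq_square F_def G_def T_def power_add mult_ac)
  also have "\<dots> = ((1 - I * q ^ Suc j) * qbinom q (Suc i) (Suc s)) * A * (F * T / (G * T))"
    unfolding b1 b2 A_def by (simp only: mult_ac)
  also have "\<dots> = (I / S * (1 - T) * qbinom q i s) * A * (F * T / (G * T))
      + ((1 - q * T * I) * qbinom q i (Suc s)) * A * (F * T / (G * T))"
    unfolding key by (simp only: distrib_right)
  also have "(I / S * (1 - T) * qbinom q i s) * A * (F * T / (G * T))
      = linearization_coeff i j s * (1 - q ^ Suc (j + s))\<^sup>2"
  proof -
    have "q ^ (s * (j + s)) = F / S" "q ^ (i * (j + s)) = G / I"
      by (simp_all add: F_def G_def S_def I_def t_def power_add)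
    then have "linearization_coeff i j s * (1 - q ^ Suc (j + s))\<^sup>2
        = qbinom q i s * qbinom q (i + j) i * (1 - T) * ((1 - T) * qbinom q (j + s) i) * (F / S / (G / I))"
      by (simp add: linearization_coeff_def power2_eq_square T_def t_def mult_ac)
    then show ?thesis
      unfolding b3 A_def using nz by (simp add: mult_ac)
  qed
  also have "((1 - q * T * I) * qbinom q i (Suc s)) * A * (F * T / (G * T))
      = linearization_coeff i j (Suc s) * node_gap i (j + Suc s)"
    unfolding linearization_coeff_def node_gap_def js(1) A_def
    using nz by (simp add: power_add F_def[symmetric] G_def[symmetric] T_def[symmetric] I_def[symmetric] mult_ac)
  finally show ?thesis .
qed

text \<open>A \<open>q\<close>-analogue of the expansion of \<open>binomial(k+i,2i) binomial(k+j,2j)\<close> in the polynomials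
  \<open>binomial(k+l,2l)\<close>, proved by adjoining one linear factor to \<open>e\<^sub>i\<close> at a time.\<close>

lemma newton_basis_linearization:
  "newton_basis i k * newton_basis j k = (\<Sum>s\<le>i. linearization_coeff i j s * newton_basis (j + s) k)"
proof (induction i)
  case 0
  then show ?case by (simp add: newton_basis_def linearization_coeff_def)
next
  case (Suc i)
  let ?e = "\<lambda>t. newton_basis t k" and ?C = "linearization_coeff i j"
  have nz: "(1 - q ^ Suc i)\<^sup>2 \<noteq> 0"
    using one_minus_power_Suc_nonzero[of i] by simp
  have last: "?C (Suc i) = 0"
    by (simp add: linearization_coeff_def qbinom_eq_0)
  define L where "L = (1 - q ^ k / q ^ i) * (1 - q ^ Suc i * q ^ k) / q ^ k"
  have L: "L * ?e t = (1 - q ^ Suc t)\<^sup>2 * ?e (Suc t) + node_gap i t * ?e t" for t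
    unfolding L_def by (rule newton_basis_node_shift)
  have "(1 - q ^ Suc i)\<^sup>2 * (?e (Suc i) * ?e j) = L * (?e i * ?e j)"
    unfolding mult.assoc[symmetric] newton_basis_Suc L_def ..
  also have "\<dots> = (\<Sum>s\<le>i. ?C s * (L * ?e (j + s)))"
    unfolding Suc.IH sum_distrib_left by (intro sum.cong) (simp_all only: mult_ac)
  also have "\<dots> = (\<Sum>s\<le>i. ?C s * (1 - q ^ Suc (j + s))\<^sup>2 * ?e (j + Suc s))
       + (\<Sum>s\<le>i. ?C s * node_gap i (j + s) * ?e (j + s))"
    unfolding L by (simp only: distrib_left sum.distrib mult.assoc add_Suc_right)
  also have "(\<Sum>s\<le>i. ?C s * node_gap i (j + s) * ?e (j + s))
      = (\<Sum>s\<le>Suc i. ?C s * node_gap i (j + s) * ?e (j + s))"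
    using last by simp
  also have "\<dots> = ?C 0 * node_gap i j * ?e j + (\<Sum>s\<le>i. ?C (Suc s) * node_gap i (j + Suc s) * ?e (j + Suc s))"
    by (subst sum.atMost_Suc_shift) simp
  finally have "(1 - q ^ Suc i)\<^sup>2 * (?e (Suc i) * ?e j)
      = ?C 0 * node_gap i j * ?e j + (\<Sum>s\<le>i. (?C s * (1 - q ^ Suc (j + s))\<^sup>2
          + ?C (Suc s) * node_gap i (j + Suc s)) * ?e (j + Suc s))"
    by (simp only: distrib_right sum.distrib add_ac)
  also have "\<dots> = (1 - q ^ Suc i)\<^sup>2 * (\<Sum>s\<le>Suc i. linearization_coeff (Suc i) j s * ?e (j + s))"
    unfolding linearization_coeff_Suc[symmetric] linearization_coeff_0[symmetric] sum.atMost_Suc_shift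
    by (simp only: sum_distrib_left distrib_left mult.assoc add_0_right)
  finally show ?case
    using nz by (simp only: mult_cancel_left simp_thms)
qed

end

section \<open>The semiring of non-negative Laurent polynomials\<close>

lemma nonneg_laurent_poly_superset:
  assumes "finite S" "\<And>i. c i \<ge> 0" "\<And>i. i \<notin> S \<Longrightarrow> c i = 0"
  shows "nonneg_laurent_poly (\<Sum>i\<in>S. of_int (c i) * qvar powi i)"
proof -
  have sub: "{i. c i \<noteq> 0} \<subseteq> S" using assms(3) by auto
  have "(\<Sum>i | c i \<noteq> 0. of_int (c i) * qvar powi i) = (\<Sum>i\<in>S. of_int (c i) * qvar powi i)"
    using assms(1) sub by (intro sum.mono_neutral_left) auto
  then show ?thesis
    unfolding nonneg_laurent_poly_def using assms sub finite_subset by (intro exI[of _ c]) auto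
qed

lemma nonneg_laurent_poly_monomial:
  assumes "a \<ge> 0"
  shows "nonneg_laurent_poly (of_int a * qvar powi i)"
  using nonneg_laurent_poly_superset[of "{i}" "\<lambda>j. if j = i then a else 0"] assms by simp

lemma nonneg_laurent_poly_0 [simp]: "nonneg_laurent_poly 0"
  using nonneg_laurent_poly_monomial[of 0 0] by simp

lemma nonneg_laurent_poly_add:
  assumes "nonneg_laurent_poly f" "nonneg_laurent_poly g"
  shows "nonneg_laurent_poly (f + g)"
proof -
  obtain c where c: "finite {i. c i \<noteq> 0}" "\<And>i. c i \<ge> 0" "f = (\<Sum>i | c i \<noteq> 0. of_int (c i) * qvar powi i)"
    using assms(1) unfolding nonneg_laurent_poly_def by auto
  obtain d where d: "finite {i. d i \<noteq> 0}" "\<And>i. d i \<ge> 0" "g = (\<Sum>i | d i \<noteq> 0. of_int (d i) * qvar powi i)"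
    using assms(2) unfolding nonneg_laurent_poly_def by auto
  let ?S = "{i. c i \<noteq> 0} \<union> {i. d i \<noteq> 0}"
  have "f = (\<Sum>i\<in>?S. of_int (c i) * qvar powi i)" "g = (\<Sum>i\<in>?S. of_int (d i) * qvar powi i)"
    unfolding c(3) d(3) using c(1) d(1) by (auto intro!: sum.mono_neutral_left)
  then have "f + g = (\<Sum>i\<in>?S. of_int (c i + d i) * qvar powi i)"
    by (simp only: sum.distrib[symmetric] of_int_add distrib_right)
  then show ?thesis
    using nonneg_laurent_poly_superset[of ?S "\<lambda>i. c i + d i"] c d by auto
qed

lemma nonneg_laurent_poly_sum:
  "(\<And>x. x \<in> A \<Longrightarrow> nonneg_laurent_poly (f x)) \<Longrightarrow> nonneg_laurent_poly (sum f A)"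
  by (induction A rule: infinite_finite_induct) (auto intro: nonneg_laurent_poly_add)

lemma qvar_power_neq_1:
  assumes "n > 0"
  shows "qvar ^ n \<noteq> 1"
proof
  have "to_fract (p ^ n) = to_fract p ^ n" for p :: "int poly"
    by (induction n) auto
  moreover assume "qvar ^ n = 1"
  ultimately have "to_fract ([:0, 1:] ^ n :: int poly) = to_fract 1"
    by (simp add: qvar_def)
  then have "[:0, 1:] ^ n = (1 :: int poly)"
    by (simp only: to_fract_eq_iff)
  then have "poly ([:0, 1:] ^ n) 0 = (1 :: int)"
    by simp
  then show False
    using assms by (simp add: power_0_left)
qed

interpretation qv: generic_base qvar
proof
  show "qvar \<noteq> 0" by (simp add: qvar_def)
qed (rule qvar_power_neq_1)

lemma nonneg_laurent_poly_mult:
  assumes "nonneg_laurent_poly f" "nonneg_laurent_poly g"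
  shows "nonneg_laurent_poly (f * g)"
proof -
  obtain c where c: "\<And>i. c i \<ge> 0" "f = (\<Sum>i | c i \<noteq> 0. of_int (c i) * qvar powi i)"
    using assms(1) unfolding nonneg_laurent_poly_def by auto
  obtain d where d: "\<And>i. d i \<ge> 0" "g = (\<Sum>i | d i \<noteq> 0. of_int (d i) * qvar powi i)"
    using assms(2) unfolding nonneg_laurent_poly_def by auto
  have "of_int (c i) * qvar powi i * (of_int (d j) * qvar powi j) = of_int (c i * d j) * qvar powi (i + j)" for i j
    by (simp add: power_int_add)
  then show ?thesis
    unfolding c(2) d(2) sum_product using c(1) d(1)
    by (auto intro!: nonneg_laurent_poly_sum nonneg_laurent_poly_monomial simp del: of_int_mult)
qed

lemma nonneg_laurent_poly_power_int [simp]: "nonneg_laurent_poly (qvar powi i)"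
  using nonneg_laurent_poly_monomial[of 1 i] by simp

lemma nonneg_laurent_poly_power [simp]: "nonneg_laurent_poly (qvar ^ n)"
  using nonneg_laurent_poly_power_int[of "int n"] by simp

lemma nonneg_laurent_poly_1 [simp]: "nonneg_laurent_poly 1"
  using nonneg_laurent_poly_power[of 0] by simp

lemma nonneg_laurent_poly_divide_power:
  assumes "nonneg_laurent_poly f"
  shows "nonneg_laurent_poly (f / qvar ^ n)"
  using nonneg_laurent_poly_mult[OF assms nonneg_laurent_poly_power_int[of "- int n"]]
  by (simp add: power_int_minus divide_inverse)

lemma nonneg_laurent_poly_prod:
  "(\<And>x. x \<in> A \<Longrightarrow> nonneg_laurent_poly (f x)) \<Longrightarrow> nonneg_laurent_poly (prod f A)"
  by (induction A rule: infinite_finite_induct) (auto intro: nonneg_laurent_poly_mult)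

lemma nonneg_laurent_poly_qbinom [simp]: "nonneg_laurent_poly (qbinom qvar n k)"
proof (induction n arbitrary: k)
  case 0
  then show ?case by (cases k) (auto simp: qv.qbinom_eq_0)
next
  case (Suc n)
  then show ?case
    by (cases k) (auto simp: qv.qbinom_Pascal simp del: power_Suc
        intro!: nonneg_laurent_poly_add nonneg_laurent_poly_mult)
qed

lemma nonneg_laurent_poly_qnumber: "nonneg_laurent_poly ((1 - qvar ^ n) / (1 - qvar))"
proof -
  have "(1 - qvar ^ n) / (1 - qvar) = (\<Sum>i<n. qvar ^ i)"
    using qvar_power_neq_1[of 1] by (simp add: sum_gp_strict)
  then show ?thesis
    by (auto intro: nonneg_laurent_poly_sum)
qed

lemma nonneg_laurent_poly_delannoy_coeff: "nonneg_laurent_poly (qv.delannoy_coeff m j)"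
  unfolding qv.delannoy_coeff_def qv.doubling_factor_def
  by (intro nonneg_laurent_poly_mult nonneg_laurent_poly_divide_power nonneg_laurent_poly_prod
      nonneg_laurent_poly_add) (auto simp del: power_Suc)

section \<open>Functions with non-negative Newton coefficients\<close>

text \<open>The cone of functions of \<open>k\<close> spanned by the basis over \<open>\<nat>[q, 1/q]\<close>. The inductive form
  lets linear statements be checked on the basis only.\<close>

inductive newton_positive :: "(nat \<Rightarrow> int poly fract) \<Rightarrow> bool" where
  zero: "newton_positive (\<lambda>k. 0)"
| add_basis: "nonneg_laurent_poly c \<Longrightarrow> newton_positive f \<Longrightarrow>
    newton_positive (\<lambda>k. c * qv.newton_basis j k + f k)"

lemma newton_positive_add:
  assumes "newton_positive f" "newton_positive g"
  shows "newton_positive (\<lambda>k. f k + g k)"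
  using assms(1)
  by induction (auto simp: add.assoc assms(2) intro: newton_positive.add_basis)

lemma newton_positive_scale:
  assumes "nonneg_laurent_poly c" "newton_positive f"
  shows "newton_positive (\<lambda>k. c * f k)"
  using assms(2)
proof induction
  case zero
  then show ?case using newton_positive.zero by simp
next
  case (add_basis d f j)
  then show ?case
    using newton_positive.add_basis[OF nonneg_laurent_poly_mult[OF assms(1), of d], of "\<lambda>k. c * f k" j]
    by (simp add: distrib_left mult.assoc)
qed

lemma newton_positive_basis: "newton_positive (qv.newton_basis j)"
  using newton_positive.add_basis[OF nonneg_laurent_poly_1 newton_positive.zero, of j] by simp

lemma newton_positive_sum:
  "(\<And>x. x \<in> A \<Longrightarrow> newton_positive (f x)) \<Longrightarrow> newton_positive (\<lambda>k. \<Sum>x\<in>A. f x k)"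
  by (induction A rule: infinite_finite_induct)
     (auto intro: newton_positive_add newton_positive.zero)

lemma newton_positive_basis_mult_basis:
  "newton_positive (\<lambda>k. qv.newton_basis i k * qv.newton_basis j k)"
  unfolding qv.newton_basis_linearization
  by (intro newton_positive_sum newton_positive_scale newton_positive_basis)
     (auto simp: qv.linearization_coeff_def
        intro!: nonneg_laurent_poly_mult nonneg_laurent_poly_divide_power)

lemma newton_positive_basis_mult:
  assumes "newton_positive f"
  shows "newton_positive (\<lambda>k. qv.newton_basis i k * f k)"
  using assms
proof induction
  case zero
  then show ?case using newton_positive.zero by simp
next
  case (add_basis c f j)
  then show ?case
    using newton_positive_add[OF newton_positive_scale[OF add_basis(1) newton_positive_basis_mult_basis[of i j]]]
    by (simp add: distrib_left mult_ac)
qed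

lemma newton_positive_mult:
  assumes "newton_positive f" "newton_positive g"
  shows "newton_positive (\<lambda>k. f k * g k)"
  using assms(1)
proof induction
  case zero
  then show ?case using newton_positive.zero by simp
next
  case (add_basis c f j)
  then show ?case
    using newton_positive_add[OF newton_positive_scale[OF add_basis(1) newton_positive_basis_mult[OF assms(2), of j]]]
    by (simp add: distrib_right mult.assoc)
qed

lemma newton_positive_power:
  assumes "newton_positive f"
  shows "newton_positive (\<lambda>k. f k ^ r)"
proof (induction r)
  case 0
  have "qv.newton_basis 0 = (\<lambda>k. 1)"
    by (simp add: fun_eq_iff qv.newton_basis_def)
  then show ?case using newton_positive_basis[of 0] by simp
next
  case (Suc r)
  then show ?case using newton_positive_mult[OF assms] by simp
qed

lemma newton_positive_qDelannoy:
  assumes "m \<ge> 1"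
  shows "newton_positive (\<lambda>k. qDelannoy qvar m k * qDelannoy (inverse qvar) m k)"
  unfolding qv.qDelannoy_product[OF assms]
  by (intro newton_positive_sum newton_positive_scale newton_positive_basis nonneg_laurent_poly_delannoy_coeff)

lemma newton_basis_sum:
  assumes "n \<ge> 1"
  shows "(\<Sum>k<n. (1 - qvar ^ (2 * k + 1)) / (1 - qvar ^ n) * qv.newton_basis j k / qvar ^ k)
     = qvar ^ Suc j / (1 - qvar ^ Suc j) * (1 - qvar ^ n)
         * qbinom qvar (n + j) j * qbinom qvar (n - 1) j / qvar ^ (n * Suc j)"
proof -
  obtain N where n: "n = Suc N" using assms by (cases n) auto
  have nz: "1 - qvar ^ n \<noteq> 0" unfolding n by (rule qv.one_minus_power_Suc_nonzero)
  have "(\<Sum>k<n. (1 - qvar ^ (2 * k + 1)) / (1 - qvar ^ n) * qv.newton_basis j k / qvar ^ k)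
      = (\<Sum>k<n. (1 - qvar ^ (2 * k + 1)) / qvar ^ k * qv.newton_prod j (qvar ^ k))
         / ((1 - qvar ^ n) * (qpoch qvar qvar j)\<^sup>2)"
    unfolding qv.newton_basis_def sum_divide_distrib by (intro sum.cong) (simp_all add: mult_ac)
  also have "\<dots> = qvar ^ Suc j / (1 - qvar ^ Suc j) * (1 - qvar ^ n)
         * qbinom qvar (n + j) j * qbinom qvar (n - 1) j / qvar ^ (n * Suc j)"
    unfolding qv.newton_prod_telescope unfolding n qv.centred_prod_qbinom unfolding n[symmetric]
    using nz by (simp add: n del: power_Suc mult_Suc_right mult_Suc)
  finally show ?thesis .
qed

lemma newton_basis_alternating_sum:
  assumes "n \<ge> 1"
  shows "(\<Sum>k<n. (- 1) ^ (n - k - 1) * ((1 - qvar ^ (2 * k + 1)) / (1 - qvar ^ n))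
            * qv.newton_basis j k * qvar ^ (k choose 2))
     = qvar ^ (n choose 2) * qvar ^ n * qbinom qvar (n + j) j * qbinom qvar (n - 1) j / qvar ^ (n * Suc j)"
proof -
  obtain N where n: "n = Suc N" using assms by (cases n) auto
  have nz: "1 - qvar ^ n \<noteq> 0" unfolding n by (rule qv.one_minus_power_Suc_nonzero)
  have sign: "(- 1) ^ (n - Suc k) = (- 1) ^ N * (- 1 :: int poly fract) ^ k" if "k < n" for k
  proof -
    have "N = (n - Suc k) + k" using that n by simp
    then have "(- 1 :: int poly fract) ^ N * (- 1) ^ k = (- 1) ^ (n - Suc k) * ((- 1) ^ k * (- 1) ^ k)"
      by (metis power_add mult.assoc)
    then show ?thesis by simp
  qed
  have "(\<Sum>k<n. (- 1) ^ (n - k - 1) * ((1 - qvar ^ (2 * k + 1)) / (1 - qvar ^ n))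
            * qv.newton_basis j k * qvar ^ (k choose 2))
      = (\<Sum>k<n. (- 1) ^ k * (1 - qvar ^ (2 * k + 1)) * qvar ^ (k choose 2) * qv.newton_prod j (qvar ^ k))
         * ((- 1) ^ N / ((1 - qvar ^ n) * (qpoch qvar qvar j)\<^sup>2))"
    unfolding qv.newton_basis_def sum_distrib_right by (intro sum.cong) (simp_all add: sign mult_ac)
  also have "\<dots> = qvar ^ (n choose 2) * qvar ^ n * qbinom qvar (n + j) j * qbinom qvar (n - 1) j / qvar ^ (n * Suc j)"
    unfolding qv.newton_prod_alternating_telescope unfolding n qv.centred_prod_qbinom unfolding n[symmetric]
    using nz by (simp add: n del: mult_Suc_right mult_Suc)
  finally show ?thesis .
qed

text \<open>On a basis element the denominator \<open>1 - q^(j+1)\<close> left by the telescoping is absorbed by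
  \<open>(1 - q^n) [n-1, j] = (1 - q^(j+1)) [n, j+1]\<close>.\<close>

lemma newton_positive_imp_sum:
  assumes "newton_positive f" "n \<ge> 1"
  shows "nonneg_laurent_poly (\<Sum>k<n. (1 - qvar ^ (2 * k + 1)) / (1 - qvar ^ n) * f k / qvar ^ k)"
  using assms(1)
proof induction
  case zero
  then show ?case by simp
next
  case (add_basis c f j)
  obtain N where n: "n = Suc N" using assms(2) by (cases n) auto
  have nz: "1 - qvar ^ Suc j \<noteq> 0" by (rule qv.one_minus_power_Suc_nonzero)
  have "(1 - qvar ^ n) * qbinom qvar (n - 1) j = (1 - qvar ^ Suc j) * qbinom qvar n (Suc j)"
    using qv.qbinom_Suc_Suc[of j N] by (simp add: n)
  then have b: "(1 - qvar ^ n) * qbinom qvar (n - 1) j / (1 - qvar ^ Suc j) = qbinom qvar n (Suc j)"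
    using nz by simp
  have "(\<Sum>k<n. (1 - qvar ^ (2 * k + 1)) / (1 - qvar ^ n) * qv.newton_basis j k / qvar ^ k)
      = qvar ^ Suc j * qbinom qvar (n + j) j * ((1 - qvar ^ n) * qbinom qvar (n - 1) j / (1 - qvar ^ Suc j))
          / qvar ^ (n * Suc j)"
    unfolding newton_basis_sum[OF assms(2)] by (simp add: mult_ac del: power_Suc mult_Suc_right)
  then have "nonneg_laurent_poly (\<Sum>k<n. (1 - qvar ^ (2 * k + 1)) / (1 - qvar ^ n) * qv.newton_basis j k / qvar ^ k)"
    unfolding b by (auto intro!: nonneg_laurent_poly_mult nonneg_laurent_poly_divide_power simp del: power_Suc mult_Suc_right)
  note nonneg_laurent_poly_add[OF nonneg_laurent_poly_mult[OF add_basis(1) this] add_basis.IH]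
  moreover have "c * (w * e / y) + w * z / y = w * (c * e + z) / y" for w e y z :: "int poly fract"
    by (simp add: distrib_left add_divide_distrib mult_ac)
  ultimately show ?case
    unfolding sum_distrib_left sum.distrib[symmetric] by simp
qed

lemma newton_positive_imp_alternating_sum:
  assumes "newton_positive f" "n \<ge> 1"
  shows "nonneg_laurent_poly
     (\<Sum>k<n. (- 1) ^ (n - k - 1) * ((1 - qvar ^ (2 * k + 1)) / (1 - qvar ^ n)) * f k * qvar ^ (k choose 2))"
  using assms(1)
proof induction
  case zero
  then show ?case by simp
next
  case (add_basis c f j)
  have "nonneg_laurent_poly (\<Sum>k<n. (- 1) ^ (n - k - 1) * ((1 - qvar ^ (2 * k + 1)) / (1 - qvar ^ n))
            * qv.newton_basis j k * qvar ^ (k choose 2))"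
    unfolding newton_basis_alternating_sum[OF assms(2)]
    by (auto intro!: nonneg_laurent_poly_mult nonneg_laurent_poly_divide_power simp del: mult_Suc_right)
  note nonneg_laurent_poly_add[OF nonneg_laurent_poly_mult[OF add_basis(1) this] add_basis.IH]
  then show ?case
    unfolding sum_distrib_left sum.distrib[symmetric]
    by (rule back_subst[of nonneg_laurent_poly])
       (intro sum.cong refl, simp only: distrib_left distrib_right mult_ac)
qed

text \<open>Why the denominators cancel: with \<open>x = q^m\<close>, \<open>a = q^j\<close>, write
  \<open>(1 - x) (1 - qx) = (1 - x/a) (1 - qax) + (x/a) (1 - a) (1 - qa)\<close>. The first summand turns
  \<open>[m+j, 2j]\<close> into a multiple of \<open>[m+j+1, 2j+2]\<close>; both summands become divisible by \<open>1 - qa\<close>. The remaining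
  \<open>1 - q\<^sup>2\<close> splits: \<open>1 - q\<close> divides \<open>1 - q^(2j+1)\<close> and \<open>1 - q^j\<close>, and \<open>1 + q\<close> divides
  \<open>(-1;q)\<^sub>j (-q;q)\<^sub>j\<close> unless \<open>j = 0\<close>, where the factor \<open>1 + qa\<close> takes its place.\<close>

lemma nonneg_laurent_poly_weighted_coeff:
  "nonneg_laurent_poly ((1 - qvar ^ m) * (1 - qvar ^ (m + 1)) / ((1 - qvar ^ 2) * (1 - qvar ^ Suc j))
      * qv.delannoy_coeff m j)"
proof -
  define x a where "x = qvar ^ m" and "a = qvar ^ j"
  define b where "b = qv.doubling_factor j / (1 - qvar ^ 2)"
  have nz: "a \<noteq> 0" "1 - qvar * a \<noteq> 0" "1 - qvar \<noteq> 0" "1 - qvar ^ 2 \<noteq> 0"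
    using qv.one_minus_power_nonzero[of "Suc j"] qv.one_minus_power_nonzero[of 1] qv.one_minus_power_nonzero[of 2]
    by (simp_all add: a_def)
  have split: "(1 - x) * (1 - qvar * x) = (1 - x / a) * (1 - qvar * a * x) + x / a * (1 - a) * (1 - qvar * a)"
    using nz(1) by (simp add: field_simps)
  have central: "(1 - x / a) * (1 - qvar * a * x) * qbinom qvar (m + j) (2 * j)
      = (1 - qvar * a) * ((1 + qvar * a) * (1 - qvar ^ (2 * j + 1)) * qbinom qvar (m + j + 1) (2 * j + 2))"
  proof -
    have "1 - qvar ^ (2 * j + 2) = (1 - qvar * a) * (1 + qvar * a)"
      by (simp add: a_def algebra_simps power_add mult_2 mult_2_right)
    moreover have "qvar ^ (m + j + 1) = qvar * a * x"
      by (simp add: a_def x_def power_add mult_ac)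
    ultimately show ?thesis
      using qv.central_qbinom_step[of j m] by (simp add: a_def x_def mult_ac)
  qed
  have "(1 - x) * (1 - qvar * x) * qbinom qvar (m + j) (2 * j)
      = (1 - qvar * a) * ((1 + qvar * a) * (1 - qvar ^ (2 * j + 1)) * qbinom qvar (m + j + 1) (2 * j + 2)
          + x / a * (1 - a) * qbinom qvar (m + j) (2 * j))"
    unfolding split distrib_right central by (simp only: distrib_left mult_ac)
  then have key: "(1 - x) * (1 - qvar * x) * qbinom qvar (m + j) (2 * j) / (1 - qvar * a)
      = (1 + qvar * a) * (1 - qvar ^ (2 * j + 1)) * qbinom qvar (m + j + 1) (2 * j + 2)
          + x / a * (1 - a) * qbinom qvar (m + j) (2 * j)"
    using nz(2) by simp
  have pos: "nonneg_laurent_poly ((1 + qvar * a) * (1 - qvar ^ (2 * j + 1)) * b) \<and> nonneg_laurent_poly ((1 - a) * b)"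
  proof (cases j)
    case 0
    have "(1 + qvar) * (1 - qvar) / (1 - qvar ^ 2) = 1"
      using nz(4) by (simp add: power2_eq_square algebra_simps)
    then show ?thesis
      by (simp add: 0 a_def b_def qv.doubling_factor_def)
  next
    case (Suc i)
    define d where "d = 2 * (\<Prod>l<i. (1 + qvar ^ Suc l) * (1 + qvar ^ Suc (Suc l)))"
    have d: "nonneg_laurent_poly d"
      unfolding d_def one_add_one[symmetric]
      by (intro nonneg_laurent_poly_mult nonneg_laurent_poly_add nonneg_laurent_poly_prod)
         (auto simp del: power_Suc one_add_one)
    have "qv.doubling_factor j = d * (1 + qvar)"
      unfolding qv.doubling_factor_def Suc prod.lessThan_Suc_shift d_def by (simp add: mult_ac)
    moreover have "1 - qvar ^ 2 = (1 - qvar) * (1 + qvar)"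
      by (simp add: power2_eq_square algebra_simps)
    ultimately have b: "b = d / (1 - qvar)"
      using nz(4) by (simp add: b_def)
    have "nonneg_laurent_poly ((1 + qvar ^ Suc j) * (d * ((1 - qvar ^ (2 * j + 1)) / (1 - qvar))))"
      by (intro nonneg_laurent_poly_mult nonneg_laurent_poly_add d nonneg_laurent_poly_qnumber
          nonneg_laurent_poly_1 nonneg_laurent_poly_power)
    moreover have "nonneg_laurent_poly (d * ((1 - qvar ^ j) / (1 - qvar)))"
      by (intro nonneg_laurent_poly_mult d nonneg_laurent_poly_qnumber)
    ultimately show ?thesis
      by (simp add: b a_def mult_ac)
  qed
  have "(1 - qvar ^ m) * (1 - qvar ^ (m + 1)) / ((1 - qvar ^ 2) * (1 - qvar ^ Suc j)) * qv.delannoy_coeff m j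
      = qvar ^ (j * j) / qvar ^ (m * j) * (b * ((1 - x) * (1 - qvar * x) * qbinom qvar (m + j) (2 * j) / (1 - qvar * a)))"
    by (simp add: qv.delannoy_coeff_def b_def x_def a_def mult_ac)
  also have "\<dots> = qvar ^ (j * j) / qvar ^ (m * j) *
      ((1 + qvar * a) * (1 - qvar ^ (2 * j + 1)) * b * qbinom qvar (m + j + 1) (2 * j + 2)
        + qvar ^ m / qvar ^ j * ((1 - a) * b) * qbinom qvar (m + j) (2 * j))"
    unfolding key unfolding x_def a_def by (simp only: distrib_left[of b] mult_ac)
  finally show ?thesis
    using pos by (auto intro!: nonneg_laurent_poly_mult nonneg_laurent_poly_add nonneg_laurent_poly_divide_power)
qed

lemma nonneg_laurent_poly_square_sum:
  assumes "m \<ge> 1" "n \<ge> 1"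
  shows "nonneg_laurent_poly
    (\<Sum>k<n. (1 - qvar ^ m) * (1 - qvar ^ (m + 1)) * (1 - qvar ^ (2 * k + 1)) / ((1 - qvar ^ 2) * (1 - qvar ^ n) ^ 2)
       * (qDelannoy qvar m k * qDelannoy (inverse qvar) m k) / qvar ^ k)"
proof -
  define W where "W = (1 - qvar ^ m) * (1 - qvar ^ (m + 1)) / ((1 - qvar ^ 2) * (1 - qvar ^ n))"
  have nz: "1 - qvar ^ n \<noteq> 0" using assms(2) by (intro qv.one_minus_power_nonzero) simp
  have "(\<Sum>k<n. (1 - qvar ^ m) * (1 - qvar ^ (m + 1)) * (1 - qvar ^ (2 * k + 1)) / ((1 - qvar ^ 2) * (1 - qvar ^ n) ^ 2)
       * (qDelannoy qvar m k * qDelannoy (inverse qvar) m k) / qvar ^ k)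
      = (\<Sum>k<n. \<Sum>j\<le>m. W * qv.delannoy_coeff m j
           * ((1 - qvar ^ (2 * k + 1)) / (1 - qvar ^ n) * qv.newton_basis j k / qvar ^ k))"
    unfolding qv.qDelannoy_product[OF assms(1)] sum_distrib_left sum_divide_distrib
    by (intro sum.cong refl) (simp add: W_def power2_eq_square mult_ac)
  also have "\<dots> = (\<Sum>j\<le>m. W * qv.delannoy_coeff m j
       * (\<Sum>k<n. (1 - qvar ^ (2 * k + 1)) / (1 - qvar ^ n) * qv.newton_basis j k / qvar ^ k))"
    unfolding sum_distrib_left by (rule sum.swap)
  also have "\<dots> = (\<Sum>j\<le>m. (1 - qvar ^ m) * (1 - qvar ^ (m + 1)) / ((1 - qvar ^ 2) * (1 - qvar ^ Suc j))
       * qv.delannoy_coeff m j * (qvar ^ Suc j * qbinom qvar (n + j) j * qbinom qvar (n - 1) j / qvar ^ (n * Suc j)))"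
    unfolding newton_basis_sum[OF assms(2)]
    by (intro sum.cong refl) (use nz in \<open>simp add: W_def mult_ac del: power_Suc mult_Suc_right\<close>)
  also have "nonneg_laurent_poly \<dots>"
    by (intro nonneg_laurent_poly_sum nonneg_laurent_poly_mult[OF nonneg_laurent_poly_weighted_coeff]
        nonneg_laurent_poly_divide_power nonneg_laurent_poly_mult nonneg_laurent_poly_power nonneg_laurent_poly_qbinom)
  finally show ?thesis .
qed

theorem theorem1p7:
  fixes m n r :: nat
  assumes "m \<ge> 1" and "n \<ge> 1" and "r \<ge> 1"
  shows "nonneg_laurent_poly
           (\<Sum>k=0..n - 1. (1 - qvar ^ m) * (1 - qvar ^ (m + 1)) * (1 - qvar ^ (2 * k + 1))
               / ((1 - qvar ^ 2) * (1 - qvar ^ n) ^ 2)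
             * qDelannoy qvar m k * qDelannoy (inverse qvar) m k * qvar powi (- int k))
         \<and> nonneg_laurent_poly
           (\<Sum>k=0..n - 1. (1 - qvar ^ (2 * k + 1)) / (1 - qvar ^ n)
             * qDelannoy qvar m k ^ r * qDelannoy (inverse qvar) m k ^ r * qvar powi (- int k))
         \<and> nonneg_laurent_poly
           (\<Sum>k=0..n - 1. (- 1) ^ (n - k - 1) * ((1 - qvar ^ (2 * k + 1)) / (1 - qvar ^ n))
             * qDelannoy qvar m k ^ r * qDelannoy (inverse qvar) m k ^ r * qvar ^ (k choose 2))"
proof -
  have range: "{0..n - 1} = {..<n}"
    using assms(2) by auto
  have inv: "f * qvar powi (- int k) = f / qvar ^ k" for f k
    by (simp add: power_int_minus divide_inverse)
  have pos: "newton_positive (\<lambda>k. (qDelannoy qvar m k * qDelannoy (inverse qvar) m k) ^ r)"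
    by (rule newton_positive_power[OF newton_positive_qDelannoy[OF assms(1)]])
  show ?thesis
    unfolding range inv
    using nonneg_laurent_poly_square_sum[OF assms(1,2)]
      newton_positive_imp_sum[OF pos assms(2)] newton_positive_imp_alternating_sum[OF pos assms(2)]
    by (simp only: power_mult_distrib mult.assoc)
qed

end
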